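(* Let $j$ be a local operator in the effective topos ${\cal E}\!f\!f$ such that $j\le\neg\neg$ and $j$ forces every arithmetically definable subset of $\mathbb N$ to be decidable. Then the subtopos ${\cal E}\!f\!f_j$ of ${\cal E}\!f\!f$ determined by $j$ satisfies true arithmetic, i.e. a first-order sentence of arithmetic holds in ${\cal E}\!f\!f_j$ (interpreted in its natural numbers object) whenever it is true in the standard model $\mathbb N$.
   Context: A local operator on a topos is a map $j:\Omega\to\Omega$ with $p\to j(p)$, $j(p\wedge q)\leftrightarrow j(p)\wedge j(q)$ and $j(j(p))\to j(p)$ internally valid; ${\cal E}\!f\!f_j$ is the corresponding topos of $j$-sheaves. $\neg\neg$ denotes the double negation local operator, and local operators are ordered pointwise. In ${\cal E}\!f\!f$, a subset $D\subseteq\mathbb N$ determines a $\neg\neg$-closed subobject of the natural numbers object $N$; $j$ forces $D$ to be decidable if this subobject is decidable in ${\cal E}\!f\!f_j$ (equivalently, if $j$ forces the characteristic function of $D$ to be total). *)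

theory Defs
  imports "HOL-Algebra.Lattice" "HOL-Library.Nat_Bijection"
begin

section \<open>Kleene application\<close>

datatype recf = ZeroR | SuccR | ProjR nat | CompR recf "recf list" | PrimR recf recf | MuR recf

text \<open>\<open>reval r xs y\<close>: the \<open>\<mu>\<close>-recursive function described by \<open>r\<close> is defined at \<open>xs\<close>, with value \<open>y\<close>.\<close>

inductive reval :: "recf \<Rightarrow> nat list \<Rightarrow> nat \<Rightarrow> bool" where
  zero: "reval ZeroR xs 0"
| succ: "reval SuccR [x] (Suc x)"
| proj: "i < length xs \<Longrightarrow> reval (ProjR i) xs (xs ! i)"
| comp: "list_all2 (\<lambda>g y. reval g xs y) gs ys \<Longrightarrow> reval f ys z \<Longrightarrow> reval (CompR f gs) xs z"
| prec_0: "reval f xs y \<Longrightarrow> reval (PrimR f g) (0 # xs) y"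
| prec_Suc: "reval (PrimR f g) (n # xs) y \<Longrightarrow> reval g (n # y # xs) z \<Longrightarrow> reval (PrimR f g) (Suc n # xs) z"
| mu: "reval f (n # xs) 0 \<Longrightarrow> (\<And>i. i < n \<Longrightarrow> \<exists>y. reval f (i # xs) (Suc y)) \<Longrightarrow> reval (MuR f) xs n"

definition total_recursive1 :: "(nat \<Rightarrow> nat) \<Rightarrow> bool" where
  "total_recursive1 f \<longleftrightarrow> (\<exists>r. \<forall>x y. f x = y \<longleftrightarrow> reval r [x] y)"

definition partial_recursive2 :: "(nat \<Rightarrow> nat \<Rightarrow> nat option) \<Rightarrow> bool" where
  "partial_recursive2 f \<longleftrightarrow> (\<exists>r. \<forall>x y z. f x y = Some z \<longleftrightarrow> reval r [x, y] z)"

text \<open>Kleene application \<open>e \<cdot> n = \<phi>\<^sub>e(n)\<close> for an acceptable numbering \<open>\<phi>\<close> (in the sense of Rogers)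
  of the unary partial recursive functions: the application is itself partial recursive, and an
  index of \<open>y \<mapsto> f(x,y)\<close> can be computed from \<open>x\<close> for every partial recursive \<open>f\<close>. The standard
  Goedel numberings are acceptable, and any two acceptable numberings are recursively isomorphic,
  so that they give rise to the same effective topos.\<close>

definition kleene_application :: "(nat \<Rightarrow> nat \<Rightarrow> nat option) \<Rightarrow> bool" where
  "kleene_application app \<longleftrightarrow>
     partial_recursive2 app \<and>
     (\<forall>f. partial_recursive2 f \<longrightarrow> (\<exists>s. total_recursive1 s \<and> (\<forall>x y. app (s x) y = f x y)))"


section \<open>Truth values of the effective topos, and local operators\<close>

definition conjR :: "nat set \<Rightarrow> nat set \<Rightarrow> nat set" where
  "conjR p q = {prod_encode (a, b) | a b. a \<in> p \<and> b \<in> q}"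

definition impR :: "(nat \<Rightarrow> nat \<Rightarrow> nat option) \<Rightarrow> nat set \<Rightarrow> nat set \<Rightarrow> nat set" where
  "impR app p q = {e. \<forall>a\<in>p. \<exists>b\<in>q. app e a = Some b}"

definition iffR :: "(nat \<Rightarrow> nat \<Rightarrow> nat option) \<Rightarrow> nat set \<Rightarrow> nat set \<Rightarrow> nat set" where
  "iffR app p q = conjR (impR app p q) (impR app q p)"

definition negR :: "(nat \<Rightarrow> nat \<Rightarrow> nat option) \<Rightarrow> nat set \<Rightarrow> nat set" where
  "negR app p = impR app p {}"

definition valid :: "('i \<Rightarrow> nat set) \<Rightarrow> bool" where
  "valid P \<longleftrightarrow> (\<exists>e. \<forall>i. e \<in> P i)"

text \<open>In the effective topos \<open>\<Omega>\<close> is the set of all \<open>p \<subseteq> \<nat>\<close> with equality predicate \<open>p \<leftrightarrow> q\<close>, and every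
  morphism \<open>\<Omega> \<rightarrow> \<Omega>\<close> is induced by a function on these sets that respects this equality internally
  (first conjunct). The existence predicate \<open>p \<leftrightarrow> p\<close> of \<open>\<Omega>\<close> has a realizer independent of \<open>p\<close>; hence
  internal validity of a statement about all \<open>p : \<Omega>\<close> is the existence of a uniform realizer.\<close>

definition local_operator :: "(nat \<Rightarrow> nat \<Rightarrow> nat option) \<Rightarrow> (nat set \<Rightarrow> nat set) \<Rightarrow> bool" where
  "local_operator app j \<longleftrightarrow>
     valid (\<lambda>(p, q). impR app (iffR app p q) (iffR app (j p) (j q))) \<and>
     valid (\<lambda>p. impR app p (j p)) \<and>
     valid (\<lambda>(p, q). iffR app (j (conjR p q)) (conjR (j p) (j q))) \<and>
     valid (\<lambda>p. impR app (j (j p)) (j p))"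

definition local_operator_le ::
  "(nat \<Rightarrow> nat \<Rightarrow> nat option) \<Rightarrow> (nat set \<Rightarrow> nat set) \<Rightarrow> (nat set \<Rightarrow> nat set) \<Rightarrow> bool" where
  "local_operator_le app j k \<longleftrightarrow> valid (\<lambda>p. impR app (j p) (k p))"

definition notnot :: "(nat \<Rightarrow> nat \<Rightarrow> nat option) \<Rightarrow> nat set \<Rightarrow> nat set" where
  "notnot app p = negR app (negR app p)"


section \<open>The subtopos determined by a local operator\<close>

text \<open>The topos of \<open>j\<close>-sheaves in the effective topos is used in its standard presentation as the
  topos represented by the tripos of \<open>\<P>(\<nat>)\<close>-valued predicates with the entailment below; the effective
  topos itself is the case where \<open>j\<close> is the identity. Objects are sets \<open>X\<close> with a partial equivalence
  relation \<open>X x y \<subseteq> \<nat>\<close>, morphisms are (classes of) functional relations \<open>F x y \<subseteq> \<nat>\<close>, and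
  sheafification sends each object of the effective topos to the object with the same data.
  In this tripos \<open>\<top>\<close>, \<open>\<and>\<close> and \<open>\<exists>\<close> are computed by inhabited sets, \<open>conjR\<close> and unions.\<close>

definition entails ::
  "(nat \<Rightarrow> nat \<Rightarrow> nat option) \<Rightarrow> (nat set \<Rightarrow> nat set) \<Rightarrow> ('i \<Rightarrow> nat set) \<Rightarrow> ('i \<Rightarrow> nat set) \<Rightarrow> bool" where
  "entails app j P Q \<longleftrightarrow> valid (\<lambda>i. impR app (P i) (j (Q i)))"

text \<open>The preorder of subobjects of \<open>X\<close>, given by the strict and extensional predicates on \<open>X\<close>.\<close>

definition Sub ::
  "(nat \<Rightarrow> nat \<Rightarrow> nat option) \<Rightarrow> (nat set \<Rightarrow> nat set) \<Rightarrow> ('a \<Rightarrow> 'a \<Rightarrow> nat set) \<Rightarrow> ('a \<Rightarrow> nat set) gorder" where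
  "Sub app j X =
     \<lparr>carrier = {R. entails app j R (\<lambda>x. X x x) \<and>
                    entails app j (\<lambda>(x, y). conjR (R x) (X x y)) (\<lambda>(x, y). R y)},
      eq = (\<lambda>R T. entails app j R T \<and> entails app j T R),
      le = (\<lambda>R T. entails app j R T)\<rparr>"

text \<open>The subobject is complemented: it and some other subobject have meet \<open>\<bottom>\<close> and join \<open>\<top>\<close>.\<close>

definition decidable_sub ::
  "(nat \<Rightarrow> nat \<Rightarrow> nat option) \<Rightarrow> (nat set \<Rightarrow> nat set) \<Rightarrow> ('a \<Rightarrow> 'a \<Rightarrow> nat set) \<Rightarrow> ('a \<Rightarrow> nat set) \<Rightarrow> bool" where
  "decidable_sub app j X R \<longleftrightarrow>
     R \<in> carrier (Sub app j X) \<and>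
     (\<exists>C \<in> carrier (Sub app j X). \<exists>B T.
        least (Sub app j X) B (carrier (Sub app j X)) \<and>
        greatest (Sub app j X) T (carrier (Sub app j X)) \<and>
        greatest (Sub app j X) B (Lower (Sub app j X) {R, C}) \<and>
        least (Sub app j X) T (Upper (Sub app j X) {R, C}))"

text \<open>The morphism \<open>X \<rightarrow> Y\<close> induced by a (tracked) function \<open>f\<close>.\<close>

definition graph_mor ::
  "('a \<Rightarrow> 'a \<Rightarrow> nat set) \<Rightarrow> ('b \<Rightarrow> 'b \<Rightarrow> nat set) \<Rightarrow> ('a \<Rightarrow> 'b) \<Rightarrow> 'a \<Rightarrow> 'b \<Rightarrow> nat set" where
  "graph_mor X Y f = (\<lambda>x y. conjR (X x x) (Y (f x) y))"

definition comp_mor :: "('b \<Rightarrow> 'c \<Rightarrow> nat set) \<Rightarrow> ('a \<Rightarrow> 'b \<Rightarrow> nat set) \<Rightarrow> 'a \<Rightarrow> 'c \<Rightarrow> nat set" where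
  "comp_mor G F = (\<lambda>x z. \<Union>y. conjR (F x y) (G y z))"

definition pair_mor :: "('a \<Rightarrow> 'b \<Rightarrow> nat set) \<Rightarrow> ('a \<Rightarrow> 'c \<Rightarrow> nat set) \<Rightarrow> 'a \<Rightarrow> 'b \<times> 'c \<Rightarrow> nat set" where
  "pair_mor F G = (\<lambda>x (y, z). conjR (F x y) (G x z))"

definition prod_obj ::
  "('a \<Rightarrow> 'a \<Rightarrow> nat set) \<Rightarrow> ('b \<Rightarrow> 'b \<Rightarrow> nat set) \<Rightarrow> 'a \<times> 'b \<Rightarrow> 'a \<times> 'b \<Rightarrow> nat set" where
  "prod_obj X Y = (\<lambda>(x, y) (x', y'). conjR (X x x') (Y y y'))"

definition diagonal :: "('a \<Rightarrow> 'a \<Rightarrow> nat set) \<Rightarrow> 'a \<times> 'a \<Rightarrow> nat set" where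
  "diagonal X = (\<lambda>(x, y). X x y)"

definition pullback :: "('a \<Rightarrow> 'b \<Rightarrow> nat set) \<Rightarrow> ('b \<Rightarrow> nat set) \<Rightarrow> 'a \<Rightarrow> nat set" where
  "pullback F R = (\<lambda>x. \<Union>y. conjR (F x y) (R y))"


section \<open>The natural numbers object and its powers\<close>

definition NNO :: "nat \<Rightarrow> nat \<Rightarrow> nat set" where
  "NNO = (\<lambda>m n. if m = n then {n} else {})"

text \<open>The power \<open>N\<^sup>k\<close>, on lists of length \<open>k\<close>: \<open>N\<^sup>0\<close> is the terminal object and
  \<open>N\<^sup>k\<^sup>+\<^sup>1 = N \<times> N\<^sup>k\<close>. All other lists are nonexistent elements.\<close>

fun NNO_pow :: "nat \<Rightarrow> nat list \<Rightarrow> nat list \<Rightarrow> nat set" where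
  "NNO_pow 0 [] [] = UNIV"
| "NNO_pow (Suc k) (x # xs) (y # ys) = conjR (NNO x y) (NNO_pow k xs ys)"
| "NNO_pow _ _ _ = {}"

text \<open>The \<open>\<not>\<not>\<close>-closed subobject of the natural numbers object determined by \<open>D\<close>.\<close>

definition nat_subobject :: "nat set \<Rightarrow> nat \<Rightarrow> nat set" where
  "nat_subobject D = (\<lambda>n. if n \<in> D then {n} else {})"

definition forces_decidable ::
  "(nat \<Rightarrow> nat \<Rightarrow> nat option) \<Rightarrow> (nat set \<Rightarrow> nat set) \<Rightarrow> nat set \<Rightarrow> bool" where
  "forces_decidable app j D \<longleftrightarrow> decidable_sub app j NNO (nat_subobject D)"


section \<open>First-order arithmetic\<close>

text \<open>De Bruijn indices: in a context \<open>xs\<close>, variable \<open>i\<close> denotes \<open>xs ! i\<close>.\<close>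

datatype tm = Var nat | Zero | Succ tm | Plus tm tm | Times tm tm

datatype fm = Eq tm tm | Fls | And fm fm | Or fm fm | Imp fm fm | All fm | Ex fm

primrec tm_in_context :: "nat \<Rightarrow> tm \<Rightarrow> bool" where
  "tm_in_context k (Var i) \<longleftrightarrow> i < k"
| "tm_in_context k Zero \<longleftrightarrow> True"
| "tm_in_context k (Succ t) \<longleftrightarrow> tm_in_context k t"
| "tm_in_context k (Plus s t) \<longleftrightarrow> tm_in_context k s \<and> tm_in_context k t"
| "tm_in_context k (Times s t) \<longleftrightarrow> tm_in_context k s \<and> tm_in_context k t"

primrec in_context :: "fm \<Rightarrow> nat \<Rightarrow> bool" where
  "in_context (Eq s t) k \<longleftrightarrow> tm_in_context k s \<and> tm_in_context k t"
| "in_context Fls k \<longleftrightarrow> True"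
| "in_context (And \<phi> \<psi>) k \<longleftrightarrow> in_context \<phi> k \<and> in_context \<psi> k"
| "in_context (Or \<phi> \<psi>) k \<longleftrightarrow> in_context \<phi> k \<and> in_context \<psi> k"
| "in_context (Imp \<phi> \<psi>) k \<longleftrightarrow> in_context \<phi> k \<and> in_context \<psi> k"
| "in_context (All \<phi>) k \<longleftrightarrow> in_context \<phi> (Suc k)"
| "in_context (Ex \<phi>) k \<longleftrightarrow> in_context \<phi> (Suc k)"

definition sentence :: "fm \<Rightarrow> bool" where
  "sentence \<phi> \<longleftrightarrow> in_context \<phi> 0"

primrec tm_val :: "nat list \<Rightarrow> tm \<Rightarrow> nat" where
  "tm_val xs (Var i) = xs ! i"
| "tm_val xs Zero = 0"
| "tm_val xs (Succ t) = Suc (tm_val xs t)"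
| "tm_val xs (Plus s t) = tm_val xs s + tm_val xs t"
| "tm_val xs (Times s t) = tm_val xs s * tm_val xs t"

primrec std_sat :: "fm \<Rightarrow> nat list \<Rightarrow> bool" where
  "std_sat (Eq s t) xs \<longleftrightarrow> tm_val xs s = tm_val xs t"
| "std_sat Fls xs \<longleftrightarrow> False"
| "std_sat (And \<phi> \<psi>) xs \<longleftrightarrow> std_sat \<phi> xs \<and> std_sat \<psi> xs"
| "std_sat (Or \<phi> \<psi>) xs \<longleftrightarrow> std_sat \<phi> xs \<or> std_sat \<psi> xs"
| "std_sat (Imp \<phi> \<psi>) xs \<longleftrightarrow> (std_sat \<phi> xs \<longrightarrow> std_sat \<psi> xs)"
| "std_sat (All \<phi>) xs \<longleftrightarrow> (\<forall>x. std_sat \<phi> (x # xs))"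
| "std_sat (Ex \<phi>) xs \<longleftrightarrow> (\<exists>x. std_sat \<phi> (x # xs))"

definition arithmetical :: "nat set \<Rightarrow> bool" where
  "arithmetical D \<longleftrightarrow> (\<exists>\<phi>. in_context \<phi> 1 \<and> D = {n. std_sat \<phi> [n]})"


section \<open>Interpretation of arithmetic in the subtopos\<close>

primrec tm_mor :: "nat \<Rightarrow> tm \<Rightarrow> nat list \<Rightarrow> nat \<Rightarrow> nat set" where
  "tm_mor k (Var i) = graph_mor (NNO_pow k) NNO (\<lambda>xs. xs ! i)"
| "tm_mor k Zero = graph_mor (NNO_pow k) NNO (\<lambda>xs. 0)"
| "tm_mor k (Succ t) = comp_mor (graph_mor NNO NNO Suc) (tm_mor k t)"
| "tm_mor k (Plus s t) =
     comp_mor (graph_mor (prod_obj NNO NNO) NNO (\<lambda>(x, y). x + y)) (pair_mor (tm_mor k s) (tm_mor k t))"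
| "tm_mor k (Times s t) =
     comp_mor (graph_mor (prod_obj NNO NNO) NNO (\<lambda>(x, y). x * y)) (pair_mor (tm_mor k s) (tm_mor k t))"

definition weakening :: "nat \<Rightarrow> nat list \<Rightarrow> nat list \<Rightarrow> nat set" where
  "weakening k = graph_mor (NNO_pow (Suc k)) (NNO_pow k) tl"

text \<open>\<open>interp app j \<phi> k R\<close>: the subobject \<open>R\<close> of \<open>N\<^sup>k\<close> is the categorical interpretation of the formula \<open>\<phi>\<close>
  in a context of length \<open>k\<close>. Subobjects are determined up to isomorphism, so this is a relation.
  Equality is the pullback of the diagonal, the connectives are the Heyting algebra operations on
  subobjects, and the quantifiers are the right and left adjoints of pullback along the
  projection \<open>N\<^sup>k\<^sup>+\<^sup>1 \<rightarrow> N\<^sup>k\<close>; each adjoint value is specified as a greatest or least element.\<close>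

primrec interp ::
  "(nat \<Rightarrow> nat \<Rightarrow> nat option) \<Rightarrow> (nat set \<Rightarrow> nat set) \<Rightarrow> fm \<Rightarrow> nat \<Rightarrow> (nat list \<Rightarrow> nat set) \<Rightarrow> bool" where
  "interp app j (Eq s t) k R \<longleftrightarrow>
     R \<in> carrier (Sub app j (NNO_pow k)) \<and>
     eq (Sub app j (NNO_pow k)) R (pullback (pair_mor (tm_mor k s) (tm_mor k t)) (diagonal NNO))"
| "interp app j Fls k R \<longleftrightarrow>
     least (Sub app j (NNO_pow k)) R (carrier (Sub app j (NNO_pow k)))"
| "interp app j (And \<phi> \<psi>) k R \<longleftrightarrow>
     (\<exists>P Q. interp app j \<phi> k P \<and> interp app j \<psi> k Q \<and>
       greatest (Sub app j (NNO_pow k)) R (Lower (Sub app j (NNO_pow k)) {P, Q}))"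
| "interp app j (Or \<phi> \<psi>) k R \<longleftrightarrow>
     (\<exists>P Q. interp app j \<phi> k P \<and> interp app j \<psi> k Q \<and>
       least (Sub app j (NNO_pow k)) R (Upper (Sub app j (NNO_pow k)) {P, Q}))"
| "interp app j (Imp \<phi> \<psi>) k R \<longleftrightarrow>
     (\<exists>P Q. interp app j \<phi> k P \<and> interp app j \<psi> k Q \<and>
       greatest (Sub app j (NNO_pow k)) R
         {T \<in> carrier (Sub app j (NNO_pow k)).
            \<forall>M. greatest (Sub app j (NNO_pow k)) M (Lower (Sub app j (NNO_pow k)) {T, P}) \<longrightarrow>
                le (Sub app j (NNO_pow k)) M Q})"
| "interp app j (All \<phi>) k R \<longleftrightarrow>
     (\<exists>P. interp app j \<phi> (Suc k) P \<and>
       greatest (Sub app j (NNO_pow k)) R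
         {T \<in> carrier (Sub app j (NNO_pow k)).
            le (Sub app j (NNO_pow (Suc k))) (pullback (weakening k) T) P})"
| "interp app j (Ex \<phi>) k R \<longleftrightarrow>
     (\<exists>P. interp app j \<phi> (Suc k) P \<and>
       least (Sub app j (NNO_pow k)) R
         {T \<in> carrier (Sub app j (NNO_pow k)).
            le (Sub app j (NNO_pow (Suc k))) P (pullback (weakening k) T)})"

text \<open>A sentence holds if its interpretation is the maximal subobject of the terminal object \<open>N\<^sup>0\<close>.\<close>

definition holds_in_subtopos ::
  "(nat \<Rightarrow> nat \<Rightarrow> nat option) \<Rightarrow> (nat set \<Rightarrow> nat set) \<Rightarrow> fm \<Rightarrow> bool" where
  "holds_in_subtopos app j \<phi> \<longleftrightarrow>
     (\<exists>R. interp app j \<phi> 0 R \<and> greatest (Sub app j (NNO_pow 0)) R (carrier (Sub app j (NNO_pow 0))))"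

end

theory Submission
  imports Defs
begin

text \<open>Every formula is interpreted by the \<open>\<not>\<not>\<close>-closed subobject of \<open>N\<^sup>k\<close> that it defines in the standard
  model. Because \<open>j \<le> \<not>\<not>\<close>, \<open>j\<close> preserves \<open>{}\<close>, so that a subobject lies below a closed one as soon as all
  its inhabited points satisfy the formula; this settles equality, \<open>\<bottom>\<close>, \<open>\<and>\<close>, \<open>\<longrightarrow>\<close> and \<open>\<forall>\<close>. For \<open>\<or>\<close> and \<open>\<exists>\<close>,
  \<open>j\<close> decides the subformula, which defines an arithmetical set; a witness for \<open>\<exists>\<close> is then found by
  unbounded search, programmed with the recursion theorem inside \<open>j\<close>.\<close>

section \<open>Recursive functions\<close>

text \<open>An entailment asks for one realizer that works at every point, but its correctness may
  be argued classically at each point separately. An inhabited value of a closed predicate is just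
  the set of codes of its point, so data has to be found only where a choice is demanded: which
  disjunct, which witness. The obstacle is that \<open>j\<close> hands out a truth value
  \<open>v\<close> only as an element of \<open>j {v}\<close>, from which \<open>v\<close> itself
  need not be computable. Case distinctions, and even the recursive calls of a search, must
  therefore run behind a computable Kleisli extension for \<open>j\<close>, which
  \<open>j_bind\<close> extracts from the axioms of a local operator. A second obstacle is that
  decidability is assumed for sets of numbers, while a subformula has \<open>k\<close> free
  variables. Parameter lists are packed into one number by a polynomial that is itself a term of
  arithmetic, so that the packed set is visibly arithmetical.\<close>

definition computes :: "nat \<Rightarrow> recf \<Rightarrow> (nat list \<Rightarrow> nat option) \<Rightarrow> bool" where
  "computes k r f \<longleftrightarrow> (\<forall>xs. length xs = k \<longrightarrow> (\<forall>y. reval r xs y \<longleftrightarrow> f xs = Some y))"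

definition partial_recursive :: "nat \<Rightarrow> (nat list \<Rightarrow> nat option) \<Rightarrow> bool" where
  "partial_recursive k f \<longleftrightarrow> (\<exists>r. computes k r f)"

inductive_simps reval_ZeroR: "reval ZeroR xs y"
inductive_simps reval_SuccR: "reval SuccR xs y"
inductive_simps reval_ProjR: "reval (ProjR i) xs y"
inductive_simps reval_CompR: "reval (CompR f gs) xs y"
inductive_simps reval_PrimR_0: "reval (PrimR f g) (0 # xs) y"
inductive_simps reval_PrimR_Suc: "reval (PrimR f g) (Suc n # xs) y"
inductive_simps reval_MuR: "reval (MuR f) xs y"

lemma partial_recursive_proj:
  assumes "i < k" shows "partial_recursive k (\<lambda>xs. Some (xs ! i))"
  unfolding partial_recursive_def computes_def
  by (rule exI[of _ "ProjR i"]) (use assms in \<open>auto simp: reval_ProjR\<close>)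

lemma partial_recursive_comp1:
  assumes "partial_recursive 1 (\<lambda>xs. f (xs ! 0))" and "partial_recursive k g"
  shows "partial_recursive k (\<lambda>xs. Option.bind (g xs) f)"
proof -
  obtain r s where "computes 1 r (\<lambda>xs. f (xs ! 0))" "computes k s g"
    using assms unfolding partial_recursive_def by blast
  then have "computes k (CompR r [s]) (\<lambda>xs. Option.bind (g xs) f)"
    unfolding computes_def
    by (auto simp: reval_CompR list_all2_Cons1 bind_eq_Some_conv)
  then show ?thesis unfolding partial_recursive_def by blast
qed

lemma partial_recursive_comp2:
  assumes "partial_recursive 2 (\<lambda>xs. f (xs ! 0) (xs ! 1))" and "partial_recursive k g" "partial_recursive k h"
  shows "partial_recursive k (\<lambda>xs. Option.bind (g xs) (\<lambda>a. Option.bind (h xs) (f a)))"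
proof -
  obtain r s t where "computes 2 r (\<lambda>xs. f (xs ! 0) (xs ! 1))" "computes k s g" "computes k t h"
    using assms unfolding partial_recursive_def by blast
  then have "computes k (CompR r [s, t]) (\<lambda>xs. Option.bind (g xs) (\<lambda>a. Option.bind (h xs) (f a)))"
    unfolding computes_def
    by (auto simp: reval_CompR list_all2_Cons1 bind_eq_Some_conv)
  then show ?thesis unfolding partial_recursive_def by blast
qed

lemma partial_recursive_Suc:
  assumes "partial_recursive k (\<lambda>xs. Some (f xs))"
  shows "partial_recursive k (\<lambda>xs. Some (Suc (f xs)))"
proof -
  have "computes 1 SuccR (\<lambda>xs. Some (Suc (xs ! 0)))"
    unfolding computes_def by (auto simp: reval_SuccR length_Suc_conv)
  then have "partial_recursive 1 (\<lambda>xs. Some (Suc (xs ! 0)))"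
    unfolding partial_recursive_def by blast
  from partial_recursive_comp1[OF this assms] show ?thesis by simp
qed

lemma partial_recursive_const: "partial_recursive k (\<lambda>xs. Some c)"
proof (induction c)
  case 0
  have "computes k ZeroR (\<lambda>xs. Some 0)" unfolding computes_def by (auto simp: reval_ZeroR)
  then show ?case unfolding partial_recursive_def by blast
qed (rule partial_recursive_Suc)

lemma partial_recursive_rec:
  assumes "partial_recursive 1 (\<lambda>xs. Some (g (xs ! 0)))"
    and "partial_recursive 3 (\<lambda>xs. Some (h (xs ! 0) (xs ! 1) (xs ! 2)))"
    and "\<And>y. f 0 y = g y" and "\<And>n y. f (Suc n) y = h n (f n y) y"
  shows "partial_recursive 2 (\<lambda>xs. Some (f (xs ! 0) (xs ! 1)))"
proof -
  obtain r s where r: "computes 1 r (\<lambda>xs. Some (g (xs ! 0)))"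
    and s: "computes 3 s (\<lambda>xs. Some (h (xs ! 0) (xs ! 1) (xs ! 2)))"
    using assms unfolding partial_recursive_def by blast
  have "reval (PrimR r s) [n, y] z \<longleftrightarrow> z = f n y" for n y z
  proof (induction n arbitrary: z)
    case 0
    then show ?case using r by (auto simp: reval_PrimR_0 computes_def assms(3))
  next
    case (Suc n)
    then show ?case using s by (auto simp: reval_PrimR_Suc computes_def assms(4) numeral_3_eq_3 numeral_2_eq_2)
  qed
  then have "computes 2 (PrimR r s) (\<lambda>xs. Some (f (xs ! 0) (xs ! 1)))"
    unfolding computes_def by (auto simp: length_Suc_conv numeral_2_eq_2)
  then show ?thesis unfolding partial_recursive_def by blast
qed

text \<open>Regular minimization: every section has a zero, so the search is total and its result
  can be written with \<open>LEAST\<close>. It is what makes pairing invertible by a recursive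
  function.\<close>

lemma partial_recursive_mu:
  assumes "partial_recursive 2 (\<lambda>xs. Some (f (xs ! 0) (xs ! 1)))" and "\<And>x. \<exists>n. f n x = 0"
  shows "partial_recursive 1 (\<lambda>xs. Some (LEAST n. f n (xs ! 0) = 0))"
proof -
  obtain r where r: "computes 2 r (\<lambda>xs. Some (f (xs ! 0) (xs ! 1)))"
    using assms unfolding partial_recursive_def by blast
  have "reval (MuR r) [x] n \<longleftrightarrow> n = (LEAST n. f n x = 0)" for x n
  proof -
    have "reval (MuR r) [x] n \<longleftrightarrow> f n x = 0 \<and> (\<forall>i<n. f i x \<noteq> 0)"
      using r by (auto simp: reval_MuR computes_def not0_implies_Suc)
    also have "\<dots> \<longleftrightarrow> n = (LEAST n. f n x = 0)"
    proof
      assume "f n x = 0 \<and> (\<forall>i<n. f i x \<noteq> 0)"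
      then show "n = (LEAST n. f n x = 0)" by (intro Least_equality[symmetric] leI) auto
    qed (auto intro: LeastI_ex[OF assms(2)] dest: not_less_Least)
    finally show ?thesis .
  qed
  then have "computes 1 (MuR r) (\<lambda>xs. Some (LEAST n. f n (xs ! 0) = 0))"
    unfolding computes_def by (auto simp: length_Suc_conv)
  then show ?thesis unfolding partial_recursive_def by blast
qed

lemma partial_recursive_total2:
  assumes "partial_recursive 2 (\<lambda>xs. Some (f (xs ! 0) (xs ! 1)))"
    and "partial_recursive k (\<lambda>xs. Some (g xs))" "partial_recursive k (\<lambda>xs. Some (h xs))"
  shows "partial_recursive k (\<lambda>xs. Some (f (g xs) (h xs)))"
  using partial_recursive_comp2[OF assms] by simp

lemma partial_recursive_total1:
  assumes "partial_recursive 1 (\<lambda>xs. Some (f (xs ! 0)))" and "partial_recursive k (\<lambda>xs. Some (g xs))"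
  shows "partial_recursive k (\<lambda>xs. Some (f (g xs)))"
  using partial_recursive_comp1[OF assms] by simp

section \<open>Arithmetic and the inverse of pairing\<close>

lemma partial_recursive_plus:
  assumes "partial_recursive k (\<lambda>xs. Some (f xs))" "partial_recursive k (\<lambda>xs. Some (g xs))"
  shows "partial_recursive k (\<lambda>xs. Some (f xs + g xs))"
  by (rule partial_recursive_total2[where f = "(+)", OF partial_recursive_rec[where g = "\<lambda>y. y" and h = "\<lambda>n a y. Suc a"] assms])
     ((intro partial_recursive_Suc partial_recursive_proj)?; simp)+

lemma partial_recursive_times:
  assumes "partial_recursive k (\<lambda>xs. Some (f xs))" "partial_recursive k (\<lambda>xs. Some (g xs))"
  shows "partial_recursive k (\<lambda>xs. Some (f xs * g xs))"
  by (rule partial_recursive_total2[where f = "(*)", OF partial_recursive_rec[where g = "\<lambda>_. 0" and h = "\<lambda>n a y. y + a"] assms])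
     (auto intro!: partial_recursive_const partial_recursive_plus partial_recursive_proj)

lemma partial_recursive_pred:
  assumes "partial_recursive k (\<lambda>xs. Some (f xs))"
  shows "partial_recursive k (\<lambda>xs. Some (f xs - 1))"
  \<comment> \<open>The recursion scheme carries one parameter; a function of \<open>n\<close> alone
    gets a dummy one, filled here with \<open>f xs\<close> again.\<close>
  by (rule partial_recursive_total2[where f = "\<lambda>n _. n - 1",
        OF partial_recursive_rec[where g = "\<lambda>_. 0" and h = "\<lambda>n a y. n"] assms assms])
     (auto intro!: partial_recursive_const partial_recursive_proj)

lemma partial_recursive_minus:
  assumes "partial_recursive k (\<lambda>xs. Some (f xs))" "partial_recursive k (\<lambda>xs. Some (g xs))"
  shows "partial_recursive k (\<lambda>xs. Some (f xs - g xs))"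
  \<comment> \<open>Recursion runs over the subtrahend and iterates the predecessor, hence the
    swapped arguments.\<close>
  by (rule partial_recursive_total2[where f = "\<lambda>n y. y - n",
        OF partial_recursive_rec[where g = "\<lambda>y. y" and h = "\<lambda>n a y. a - 1"] assms(2,1)])
     ((intro partial_recursive_pred partial_recursive_proj)?; simp)+

lemma partial_recursive_triangle:
  assumes "partial_recursive k (\<lambda>xs. Some (f xs))"
  shows "partial_recursive k (\<lambda>xs. Some (triangle (f xs)))"
  by (rule partial_recursive_total2[where f = "\<lambda>n _. triangle n",
        OF partial_recursive_rec[where g = "\<lambda>y. 0" and h = "\<lambda>n a y. a + Suc n"] assms assms])
     (auto intro!: partial_recursive_const partial_recursive_plus partial_recursive_Suc partial_recursive_proj)

lemma partial_recursive_prod_encode: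
  assumes "partial_recursive k (\<lambda>xs. Some (f xs))" "partial_recursive k (\<lambda>xs. Some (g xs))"
  shows "partial_recursive k (\<lambda>xs. Some (prod_encode (f xs, g xs)))"
  unfolding prod_encode_def using assms
  by (auto intro!: partial_recursive_plus partial_recursive_triangle)

lemma triangle_mono: "m \<le> n \<Longrightarrow> triangle m \<le> triangle n"
  by (induction rule: dec_induct) auto

abbreviation pair :: "nat \<Rightarrow> nat \<Rightarrow> nat" where "pair a b \<equiv> prod_encode (a, b)"
abbreviation p1 :: "nat \<Rightarrow> nat" where "p1 n \<equiv> fst (prod_decode n)"
abbreviation p2 :: "nat \<Rightarrow> nat" where "p2 n \<equiv> snd (prod_decode n)"

text \<open>The value \<open>triangle t + a\<close> with \<open>a \<le> t\<close> encodes a pair with sum \<open>t\<close>, so that \<open>t\<close> can be found by search.\<close>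

lemma sum_prod_decode: "(LEAST t. Suc n - triangle (Suc t) = 0) = p1 n + p2 n"
proof (rule Least_equality)
  have n: "n = triangle (p1 n + p2 n) + p1 n"
    using prod_decode_inverse[of n] unfolding prod_encode_def by (metis case_prod_beta)
  then show "Suc n - triangle (Suc (p1 n + p2 n)) = 0" by simp
  show "p1 n + p2 n \<le> t" if "Suc n - triangle (Suc t) = 0" for t
  proof (rule ccontr)
    assume "\<not> p1 n + p2 n \<le> t"
    then have "triangle (Suc t) \<le> triangle (p1 n + p2 n)" by (intro triangle_mono) auto
    with that n show False by linarith
  qed
qed

lemma partial_recursive_sum_prod_decode:
  assumes "partial_recursive k (\<lambda>xs. Some (f xs))"
  shows "partial_recursive k (\<lambda>xs. Some (p1 (f xs) + p2 (f xs)))"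
proof (rule partial_recursive_total1[OF _ assms], unfold sum_prod_decode[symmetric], rule partial_recursive_mu)
  show "partial_recursive 2 (\<lambda>xs. Some (Suc (xs ! 1) - triangle (Suc (xs ! 0))))"
    by (intro partial_recursive_minus partial_recursive_Suc partial_recursive_triangle partial_recursive_proj) auto
  show "\<exists>n. Suc x - triangle (Suc n) = 0" for x
    by (rule exI[of _ x]) simp
qed

lemma partial_recursive_p1:
  assumes "partial_recursive k (\<lambda>xs. Some (f xs))"
  shows "partial_recursive k (\<lambda>xs. Some (p1 (f xs)))"
proof -
  \<comment> \<open>A code is \<open>triangle (a + b) + a\<close>, so the sum of the components
    determines the triangular part to remove.\<close>
  have eq: "p1 n = n - triangle (p1 n + p2 n)" for n
    using prod_decode_inverse[of n] unfolding prod_encode_def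
    by (metis case_prod_beta diff_add_inverse)
  have "partial_recursive 1 (\<lambda>xs. Some (p1 (xs ! 0)))"
    by (subst eq)
       (intro partial_recursive_minus partial_recursive_triangle partial_recursive_sum_prod_decode
         partial_recursive_proj; simp)
  from partial_recursive_total1[OF this assms] show ?thesis .
qed

lemma partial_recursive_p2:
  assumes "partial_recursive k (\<lambda>xs. Some (f xs))"
  shows "partial_recursive k (\<lambda>xs. Some (p2 (f xs)))"
proof -
  have "partial_recursive k (\<lambda>xs. Some (p1 (f xs) + p2 (f xs) - p1 (f xs)))"
    by (intro partial_recursive_minus partial_recursive_sum_prod_decode partial_recursive_p1 assms)
  then show ?thesis by simp
qed

section \<open>Computability relative to an acceptable numbering\<close>

locale kleene =
  fixes app :: "nat \<Rightarrow> nat \<Rightarrow> nat option"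
  assumes kleene_application: "kleene_application app"
begin

definition computable :: "(nat \<Rightarrow> nat option) \<Rightarrow> bool" where
  "computable f \<longleftrightarrow> (\<exists>e. \<forall>x. app e x = f x)"

lemma partial_recursive2_iff: "partial_recursive2 f \<longleftrightarrow> partial_recursive 2 (\<lambda>xs. f (xs ! 0) (xs ! 1))"
proof -
  have "(\<forall>x y z. f x y = Some z \<longleftrightarrow> reval r [x, y] z) \<longleftrightarrow> computes 2 r (\<lambda>xs. f (xs ! 0) (xs ! 1))" for r
    unfolding computes_def numeral_2_eq_2 by (auto simp: length_Suc_conv)
  then show ?thesis unfolding partial_recursive2_def partial_recursive_def by simp
qed

lemma partial_recursive_app: "partial_recursive 2 (\<lambda>xs. app (xs ! 0) (xs ! 1))"
  using kleene_application unfolding kleene_application_def partial_recursive2_iff by blast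

text \<open>Forward, application is partial recursive and the index a constant. Backward,
  acceptability is applied to a binary function that ignores its first argument, and any value of
  \<open>s\<close> is an index.\<close>

lemma computable_iff: "computable f \<longleftrightarrow> partial_recursive 1 (\<lambda>xs. f (xs ! 0))"
proof
  assume "computable f"
  then obtain e where "\<And>x. app e x = f x" unfolding computable_def by blast
  then show "partial_recursive 1 (\<lambda>xs. f (xs ! 0))"
    using partial_recursive_comp2[OF partial_recursive_app partial_recursive_const[of 1 e] partial_recursive_proj[of 0 1]]
    by simp
next
  assume "partial_recursive 1 (\<lambda>xs. f (xs ! 0))"
  from partial_recursive_comp1[OF this partial_recursive_proj[of 1 2]]
  have "partial_recursive2 (\<lambda>x y. f y)" unfolding partial_recursive2_iff by simp
  then obtain s where "\<And>x y. app (s x) y = f y"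
    using kleene_application unfolding kleene_application_def by blast
  then show "computable f" unfolding computable_def by blast
qed

lemma computable_const: "computable (\<lambda>x. Some c)"
  unfolding computable_iff by (rule partial_recursive_const)

lemma computable_id: "computable (\<lambda>x. Some x)"
  unfolding computable_iff by (simp add: partial_recursive_proj)

lemma computable_Suc: "computable (\<lambda>x. Some (f x)) \<Longrightarrow> computable (\<lambda>x. Some (Suc (f x)))"
  unfolding computable_iff by (rule partial_recursive_Suc)

lemma computable_plus:
  "computable (\<lambda>x. Some (f x)) \<Longrightarrow> computable (\<lambda>x. Some (g x)) \<Longrightarrow> computable (\<lambda>x. Some (f x + g x))"
  unfolding computable_iff by (rule partial_recursive_plus)

lemma computable_times:
  "computable (\<lambda>x. Some (f x)) \<Longrightarrow> computable (\<lambda>x. Some (g x)) \<Longrightarrow> computable (\<lambda>x. Some (f x * g x))"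
  unfolding computable_iff by (rule partial_recursive_times)

lemma computable_pair:
  "computable (\<lambda>x. Some (f x)) \<Longrightarrow> computable (\<lambda>x. Some (g x)) \<Longrightarrow> computable (\<lambda>x. Some (pair (f x) (g x)))"
  unfolding computable_iff by (rule partial_recursive_prod_encode)

lemma computable_p1: "computable (\<lambda>x. Some (f x)) \<Longrightarrow> computable (\<lambda>x. Some (p1 (f x)))"
  unfolding computable_iff by (rule partial_recursive_p1)

lemma computable_p2: "computable (\<lambda>x. Some (f x)) \<Longrightarrow> computable (\<lambda>x. Some (p2 (f x)))"
  unfolding computable_iff by (rule partial_recursive_p2)

lemma computable_app:
  assumes "computable (\<lambda>x. Some (f x))" "computable (\<lambda>x. Some (g x))"
  shows "computable (\<lambda>x. app (f x) (g x))"
  using partial_recursive_comp2[OF partial_recursive_app] assms unfolding computable_iff by fastforce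

lemma computable_comp:
  assumes "computable f" "computable (\<lambda>x. Some (g x))"
  shows "computable (\<lambda>x. f (g x))"
  using partial_recursive_comp1[of f] assms unfolding computable_iff by fastforce

lemma computable_compose:
  assumes "computable (\<lambda>x. Some (f x))" "computable (\<lambda>x. Some (g x))"
  shows "computable (\<lambda>x. Some (f (g x)))"
  using computable_comp[OF assms] .

text \<open>The continuation may use both the input and the intermediate value, so its computability
  is stated on their code \<open>z\<close>.\<close>

lemma computable_bind:
  assumes "computable f" "computable (\<lambda>z. g (p1 z) (p2 z))"
  shows "computable (\<lambda>x. Option.bind (f x) (g x))"
proof -
  have "partial_recursive 2 (\<lambda>xs. Option.bind (Some (pair (xs ! 0) (xs ! 1))) (\<lambda>z. g (p1 z) (p2 z)))"
    using assms(2) unfolding computable_iff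
    by (intro partial_recursive_comp1 partial_recursive_prod_encode partial_recursive_proj) auto
  then have "partial_recursive 2 (\<lambda>xs. g (xs ! 0) (xs ! 1))" by simp
  from partial_recursive_comp2[OF this partial_recursive_proj[of 0 1]] show ?thesis
    using assms(1) unfolding computable_iff by fastforce
qed

lemma computable_if:
  assumes "computable (\<lambda>x. Some (c x))" "computable f" "computable g"
  shows "computable (\<lambda>x. if c x = 0 then f x else g x)"
proof -
  obtain d e where d: "\<And>x. app d x = f x" and e: "\<And>x. app e x = g x"
    using assms(2,3) unfolding computable_def by blast
  \<comment> \<open>The branch not taken may diverge, so the choice is made between the indices
    \<open>d\<close> and \<open>e\<close> before anything is applied. With truncated subtraction
    \<open>1 - c x\<close> is 1 if \<open>c x = 0\<close> and 0 otherwise.\<close>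
  have "computable (\<lambda>x. Some ((1 - c x) * d + (1 - (1 - c x)) * e))"
    using assms(1) unfolding computable_iff
    by (intro partial_recursive_plus partial_recursive_times partial_recursive_minus partial_recursive_const)
  from computable_app[OF this computable_id]
  have "computable (\<lambda>x. app ((1 - c x) * d + (1 - (1 - c x)) * e) x)" .
  also have "(\<lambda>x. app ((1 - c x) * d + (1 - (1 - c x)) * e) x) = (\<lambda>x. if c x = 0 then f x else g x)"
    by (auto simp: d e)
  finally show ?thesis .
qed

text \<open>The s-m-n half of acceptability, curried. Since \<open>s\<close> is itself computable,
  realizers can build closures at run time.\<close>

lemma abstraction:
  assumes "computable f"
  obtains s where "computable (\<lambda>x. Some (s x))" "\<And>x y. app (s x) y = f (pair x y)"
proof -
  have "partial_recursive 2 (\<lambda>xs. Option.bind (Some (pair (xs ! 0) (xs ! 1))) f)"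
    using assms unfolding computable_iff
    by (intro partial_recursive_comp1 partial_recursive_prod_encode partial_recursive_proj) auto
  then have "partial_recursive2 (\<lambda>x y. f (pair x y))" unfolding partial_recursive2_iff by simp
  then obtain s where s: "total_recursive1 s" "\<And>x y. app (s x) y = f (pair x y)"
    using kleene_application unfolding kleene_application_def by blast
  have "partial_recursive 1 (\<lambda>xs. Some (s (xs ! 0)))"
    using s(1) unfolding total_recursive1_def partial_recursive_def computes_def
    by (fastforce simp: length_Suc_conv)
  then show thesis using that s(2) unfolding computable_iff by blast
qed

lemmas computable_intros = computable_const computable_id computable_Suc computable_plus computable_times
  computable_pair computable_p1 computable_p2 computable_app computable_bind computable_if

text \<open>Kleene's diagonal argument: \<open>s x\<close> is an index of \<open>f\<close> with the
  value of \<open>x\<close> applied to itself plugged in. If \<open>i\<close> is an index of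
  \<open>s\<close>, then \<open>i\<close> applied to itself is \<open>s i\<close>, so
  \<open>s i\<close> receives its own index.\<close>

lemma recursion_theorem:
  assumes "computable f"
  obtains e where "\<And>y. app e y = f (pair e y)"
proof -
  have "computable (\<lambda>z. Option.bind (app (p1 z) (p1 z)) (\<lambda>e. f (pair e (p2 z))))"
    by (intro computable_intros computable_comp[OF assms])
  then obtain s where s: "computable (\<lambda>x. Some (s x))"
    "\<And>x y. app (s x) y = Option.bind (app x x) (\<lambda>e. f (pair e y))"
    by (rule abstraction) auto
  from s(1) obtain i where "\<And>x. app i x = Some (s x)" unfolding computable_def by blast
  with s(2)[of i] that[of "s i"] show thesis by simp
qed

end

section \<open>The logic of the subtopos\<close>

lemma mem_conjR: "n \<in> conjR p q \<longleftrightarrow> p1 n \<in> p \<and> p2 n \<in> q"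
proof
  assume "p1 n \<in> p \<and> p2 n \<in> q"
  then have "pair (p1 n) (p2 n) \<in> conjR p q" unfolding conjR_def by blast
  then show "n \<in> conjR p q" by simp
qed (auto simp: conjR_def)

lemma impRE:
  assumes "e \<in> impR app p q" "a \<in> p"
  obtains b where "app e a = Some b" "b \<in> q"
  using assms unfolding impR_def by blast

lemma impRI: "(\<And>a. a \<in> p \<Longrightarrow> \<exists>b\<in>q. app e a = Some b) \<Longrightarrow> e \<in> impR app p q"
  unfolding impR_def by blast

locale subtopos = kleene +
  fixes j :: "nat set \<Rightarrow> nat set"
  assumes local_operator: "local_operator app j"
    and le_notnot: "local_operator_le app j (notnot app)"
begin

text \<open>Everything realizes the negation of \<open>{}\<close>, so its double negation is empty,
  and a realizer of \<open>j \<le> \<not>\<not>\<close> has no value to return on an element of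
  \<open>j {}\<close>.\<close>

lemma j_empty: "j {} = {}"
proof -
  obtain e where "\<And>p. e \<in> impR app (j p) (notnot app p)"
    using le_notnot unfolding local_operator_le_def valid_def by blast
  then have "e \<in> impR app (j {}) (notnot app {})" .
  moreover have "notnot app {} = {}" by (auto simp: notnot_def negR_def impR_def)
  ultimately show ?thesis by (auto simp: impR_def split: if_splits)
qed

text \<open>Monotonicity is not among the axioms and comes from extensionality: if \<open>p\<close>
  implies \<open>j q\<close>, then \<open>p\<close> is equivalent to its conjunction with
  \<open>j q\<close>. Apply \<open>j\<close> to both sides, split the conjunction to reach
  \<open>j (j q)\<close>, and collapse it.\<close>

lemma j_bind:
  "\<exists>b. computable (\<lambda>x. Some (b x)) \<and>
       (\<forall>h p q. h \<in> impR app p (j q) \<longrightarrow> b h \<in> impR app (j p) (j q))"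
proof -
  obtain e1 where e1: "\<And>p q. e1 \<in> impR app (iffR app p q) (iffR app (j p) (j q))"
    using local_operator unfolding local_operator_def valid_def by auto
  obtain e3 where e3: "\<And>p q. e3 \<in> iffR app (j (conjR p q)) (conjR (j p) (j q))"
    using local_operator unfolding local_operator_def valid_def by auto
  obtain e4 where e4: "\<And>p. e4 \<in> impR app (j (j p)) (j p)"
    using local_operator unfolding local_operator_def valid_def by auto
  have "computable (\<lambda>z. Option.bind (app (p1 z) (p2 z)) (\<lambda>y. Some (pair (p2 z) y)))"
    by (intro computable_intros)
  \<comment> \<open>\<open>w h\<close> realizes that \<open>p\<close> implies its conjunction with
    \<open>j q\<close>; the projection \<open>k\<close> below realizes the converse.\<close>
  then obtain w where w: "computable (\<lambda>x. Some (w x))"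
    "\<And>h x. app (w h) x = Option.bind (app h x) (\<lambda>y. Some (pair x y))"
    by (rule abstraction) auto
  have "computable (\<lambda>z. Some (p1 z))" by (intro computable_intros)
  then obtain k where k: "\<And>z. app k z = Some (p1 z)" unfolding computable_def by blast
  let ?F = "\<lambda>z. Option.bind (app e1 (pair (w (p1 z)) k)) (\<lambda>r. Option.bind (app (p1 r) (p2 z))
    (\<lambda>y. Option.bind (app (p1 e3) y) (\<lambda>r'. app e4 (p2 r'))))"
  have "computable ?F"
    by (intro computable_intros computable_comp[OF w(1)])
  then obtain b where b: "computable (\<lambda>x. Some (b x))" "\<And>h x. app (b h) x = ?F (pair h x)"
    by (rule abstraction) blast
  have "b h \<in> impR app (j p) (j q)" if h: "h \<in> impR app p (j q)" for h p q
  proof -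
    let ?pq = "conjR p (j q)"
    have "w h \<in> impR app p ?pq"
      using h by (fastforce simp: impR_def mem_conjR w(2))
    moreover have "k \<in> impR app ?pq p"
      by (simp add: impR_def mem_conjR k)
    ultimately have "pair (w h) k \<in> iffR app p ?pq"
      by (simp add: iffR_def mem_conjR)
    with e1 obtain r where r: "app e1 (pair (w h) k) = Some r" "r \<in> iffR app (j p) (j ?pq)"
      unfolding impR_def by blast
    show ?thesis
    proof (rule impRI)
      fix x assume "x \<in> j p"
      with r(2) obtain y where y: "app (p1 r) x = Some y" "y \<in> j ?pq"
        unfolding iffR_def mem_conjR impR_def by blast
      from e3[of p "j q"] have "p1 e3 \<in> impR app (j ?pq) (conjR (j p) (j (j q)))"
        by (simp add: iffR_def mem_conjR[of e3])
      from this y(2) obtain r' where r': "app (p1 e3) y = Some r'" "p2 r' \<in> j (j q)"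
        by (rule impRE) (simp add: mem_conjR)
      with e4 obtain v where "app e4 (p2 r') = Some v" "v \<in> j q"
        unfolding impR_def by blast
      then show "\<exists>v\<in>j q. app (b h) x = Some v" by (simp add: b(2) r y r')
    qed
  qed
  with b(1) show ?thesis by blast
qed

lemma j_unit:
  obtains u where "\<And>p. u \<in> impR app p (j p)"
  using local_operator unfolding local_operator_def valid_def by auto

lemma entailsI_local:
  assumes "computable f" "\<And>i a. a \<in> P i \<Longrightarrow> \<exists>b\<in>j (Q i). f a = Some b"
  shows "entails app j P Q"
proof -
  obtain e where e: "\<And>a. app e a = f a" using assms(1) unfolding computable_def by blast
  have "e \<in> impR app (P i) (j (Q i))" for i
    using assms(2) by (intro impRI) (simp add: e)
  then show ?thesis unfolding entails_def valid_def by blast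
qed

lemma entailsI:
  assumes "computable f" "\<And>i a. a \<in> P i \<Longrightarrow> \<exists>b\<in>Q i. f a = Some b"
  shows "entails app j P Q"
proof -
  obtain u where u: "\<And>p. u \<in> impR app p (j p)" using j_unit by blast
  show ?thesis
  proof (rule entailsI_local)
    show "computable (\<lambda>a. Option.bind (f a) (app u))"
      by (intro computable_intros assms)
    fix i a assume "a \<in> P i"
    with assms(2) obtain b where "f a = Some b" "b \<in> Q i" by blast
    with u[of "Q i"] show "\<exists>b\<in>j (Q i). Option.bind (f a) (app u) = Some b"
      by (auto simp: impR_def)
  qed
qed

lemma entailsI_total:
  assumes "computable (\<lambda>x. Some (f x))" "\<And>i a. a \<in> P i \<Longrightarrow> f a \<in> Q i"
  shows "entails app j P Q"
  using assms by (intro entailsI) auto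

section \<open>Entailment as a preorder with meets\<close>

lemma entails_refl: "entails app j P P"
  by (rule entailsI_total[OF computable_id])

lemma entails_trans:
  assumes "entails app j P Q" "entails app j Q R"
  shows "entails app j P R"
proof -
  obtain d e where d: "\<And>i. d \<in> impR app (P i) (j (Q i))" and e: "\<And>i. e \<in> impR app (Q i) (j (R i))"
    using assms unfolding entails_def valid_def by blast
  obtain b where "computable (\<lambda>x. Some (b x))"
    and b: "\<And>h p q. h \<in> impR app p (j q) \<Longrightarrow> b h \<in> impR app (j p) (j q)"
    using j_bind by blast
  have "computable (\<lambda>a. Option.bind (app d a) (app (b e)))"
    by (intro computable_intros)
  then obtain c where c: "\<And>a. app c a = Option.bind (app d a) (app (b e))"
    unfolding computable_def by blast
  have "c \<in> impR app (P i) (j (R i))" for i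
  proof (rule impRI)
    fix a assume "a \<in> P i"
    with d obtain y where y: "app d a = Some y" "y \<in> j (Q i)" by (rule impRE)
    from b[OF e] y(2) obtain z where "app (b e) y = Some z" "z \<in> j (R i)" by (rule impRE)
    with y show "\<exists>z\<in>j (R i). app c a = Some z" by (simp add: c)
  qed
  then show ?thesis unfolding entails_def valid_def by blast
qed

lemma entails_conjI:
  assumes "entails app j P Q" "entails app j P R"
  shows "entails app j P (\<lambda>i. conjR (Q i) (R i))"
proof -
  obtain d e where d: "\<And>i. d \<in> impR app (P i) (j (Q i))" and e: "\<And>i. e \<in> impR app (P i) (j (R i))"
    using assms unfolding entails_def valid_def by blast
  obtain k where k: "\<And>p q. k \<in> iffR app (j (conjR p q)) (conjR (j p) (j q))"
    using local_operator unfolding local_operator_def valid_def by auto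
  have "computable (\<lambda>a. Option.bind (app d a) (\<lambda>x. Option.bind (app e a) (\<lambda>y. app (p2 k) (pair x y))))"
    by (intro computable_intros)
  then obtain c where c: "\<And>a. app c a = Option.bind (app d a) (\<lambda>x. Option.bind (app e a) (\<lambda>y. app (p2 k) (pair x y)))"
    unfolding computable_def by blast
  have "c \<in> impR app (P i) (j (conjR (Q i) (R i)))" for i
  proof (rule impRI)
    fix a assume a: "a \<in> P i"
    obtain x where x: "app d a = Some x" "x \<in> j (Q i)" using d[of i] a unfolding impR_def by blast
    obtain y where y: "app e a = Some y" "y \<in> j (R i)" using e[of i] a unfolding impR_def by blast
    have "pair x y \<in> conjR (j (Q i)) (j (R i))" using x y by (simp add: mem_conjR)
    then obtain z where "app (p2 k) (pair x y) = Some z" "z \<in> j (conjR (Q i) (R i))"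
      using k[of "Q i" "R i"] unfolding iffR_def mem_conjR[of k] impR_def by blast
    then show "\<exists>b\<in>j (conjR (Q i) (R i)). app c a = Some b" by (simp add: c x y)
  qed
  then show ?thesis unfolding entails_def valid_def by blast
qed

lemma entails_conjD1: "entails app j (\<lambda>i. conjR (P i) (Q i)) P"
  by (rule entailsI_total[where f = p1]) (intro computable_intros, simp add: mem_conjR)

lemma entails_conjD2: "entails app j (\<lambda>i. conjR (P i) (Q i)) Q"
  by (rule entailsI_total[where f = p2]) (intro computable_intros, simp add: mem_conjR)

text \<open>A realizer would send \<open>a\<close> into \<open>j {}\<close>. This is how an
  entailment yields classical information about a single point.\<close>

lemma entails_nonempty: "entails app j P Q \<Longrightarrow> a \<in> P i \<Longrightarrow> Q i \<noteq> {}"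
  unfolding entails_def valid_def impR_def using j_empty by fastforce

lemma entails_empty: "entails app j (\<lambda>i. {}) Q"
  by (rule entailsI_total[OF computable_id]) simp

text \<open>The realizer for \<open>X\<close> is reused unchanged: where \<open>T\<close> is
  inhabited so is \<open>X\<close>, and there \<open>R\<close> is literally the same set; elsewhere
  nothing is to be realized. The case distinction is made outside and costs no computation.\<close>

lemma entails_stable:
  assumes "entails app j T X" "\<And>i a b. a \<in> T i \<Longrightarrow> b \<in> X i \<Longrightarrow> R i = X i"
  shows "entails app j T R"
proof -
  obtain e where e: "\<And>i. e \<in> impR app (T i) (j (X i))"
    using assms unfolding entails_def valid_def by blast
  have "e \<in> impR app (T i) (j (R i))" for i
  proof (cases "T i = {}")
    case False
    then obtain a where a: "a \<in> T i" by blast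
    with entails_nonempty[OF assms(1)] obtain b where "b \<in> X i" by blast
    with a have "R i = X i" by (rule assms(2))
    then show ?thesis using e[of i] by simp
  qed (simp add: impR_def)
  then show ?thesis unfolding entails_def valid_def by blast
qed

section \<open>Subobject lattices of discrete objects\<close>

definition discrete :: "('a \<Rightarrow> 'a \<Rightarrow> nat set) \<Rightarrow> bool" where
  "discrete X \<longleftrightarrow> (\<forall>x y. X x y \<noteq> {} \<longrightarrow> x = y)"

text \<open>Extensionality is automatic: a realizer of \<open>X x y\<close> exists only if
  \<open>x = y\<close>, so a projection transports elements of \<open>R\<close>. Strictness alone
  remains.\<close>

lemma carrier_Sub_iff:
  assumes "discrete X"
  shows "R \<in> carrier (Sub app j X) \<longleftrightarrow> entails app j R (\<lambda>x. X x x)"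
proof -
  have "entails app j (\<lambda>(x, y). conjR (R x) (X x y)) (\<lambda>(x, y). R y)"
    using assms unfolding discrete_def
    by (intro entailsI_total[where f = p1] computable_intros) (fastforce simp: mem_conjR)
  then show ?thesis by (simp add: Sub_def)
qed

lemma le_Sub: "le (Sub app j X) R T \<longleftrightarrow> entails app j R T"
  by (simp add: Sub_def)

lemma eq_Sub: "eq (Sub app j X) R T \<longleftrightarrow> entails app j R T \<and> entails app j T R"
  by (simp add: Sub_def)

lemma greatest_Sub_iff:
  "greatest (Sub app j X) G A \<longleftrightarrow> A \<subseteq> carrier (Sub app j X) \<and> G \<in> A \<and> (\<forall>T\<in>A. entails app j T G)"
  unfolding greatest_def le_Sub by blast

lemma least_Sub_iff:
  "least (Sub app j X) G A \<longleftrightarrow> A \<subseteq> carrier (Sub app j X) \<and> G \<in> A \<and> (\<forall>T\<in>A. entails app j G T)"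
  by (simp add: least_def le_Sub)

lemma Lower_Sub:
  assumes "P \<in> carrier (Sub app j X)" "Q \<in> carrier (Sub app j X)"
  shows "Lower (Sub app j X) {P, Q} = {T \<in> carrier (Sub app j X). entails app j T P \<and> entails app j T Q}"
  using assms unfolding Lower_def le_Sub by blast

lemma Upper_Sub:
  assumes "P \<in> carrier (Sub app j X)" "Q \<in> carrier (Sub app j X)"
  shows "Upper (Sub app j X) {P, Q} = {T \<in> carrier (Sub app j X). entails app j P T \<and> entails app j Q T}"
  using assms unfolding Upper_def le_Sub by blast

lemma discrete_NNO: "discrete NNO"
  by (simp add: discrete_def NNO_def)

text \<open>Having join \<open>T\<close> with the complement is tested on the graph
  \<open>?U\<close> of the characteristic function: \<open>D\<close> lies below it with tag 0, the
  complement with tag 1, hence so does every number.\<close>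

lemma forces_decidable_realizer:
  assumes "forces_decidable app j D"
  obtains e where "\<And>n. e \<in> impR app {n} (j {if n \<in> D then 0 else Suc 0})"
proof -
  let ?L = "Sub app j NNO" and ?R = "nat_subobject D"
  obtain C B T where RC: "?R \<in> carrier ?L" "C \<in> carrier ?L"
    and B: "least ?L B (carrier ?L)" "greatest ?L B (Lower ?L {?R, C})"
    and T: "greatest ?L T (carrier ?L)" "least ?L T (Upper ?L {?R, C})"
    using assms unfolding forces_decidable_def decidable_sub_def by blast
  note carrier = carrier_Sub_iff[OF discrete_NNO]
  have C: "n \<notin> D" if a: "a \<in> C n" for a n
  proof
    assume "n \<in> D"
    let ?M = "\<lambda>n. conjR (?R n) (C n)"
    have "?M \<in> Lower ?L {?R, C}"
      unfolding Lower_Sub[OF RC] using RC(1)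
      by (auto simp: carrier intro: entails_conjD1 entails_conjD2 entails_trans)
    then have "entails app j ?M B" using B(2) by (simp add: greatest_Sub_iff)
    moreover have "entails app j B (\<lambda>n. {})"
      using B(1) by (simp add: least_Sub_iff carrier entails_empty)
    ultimately have "entails app j ?M (\<lambda>n. {})" by (rule entails_trans)
    moreover have "pair n a \<in> ?M n" using a \<open>n \<in> D\<close> by (simp add: mem_conjR nat_subobject_def)
    ultimately show False by (auto dest: entails_nonempty)
  qed
  let ?f = "\<lambda>n. if n \<in> D then 0 else Suc 0"
  \<comment> \<open>The number is kept beside its tag so that strictness of \<open>?U\<close> is a
    projection.\<close>
  let ?U = "\<lambda>n. {pair n (?f n)}"
  have "entails app j (\<lambda>n. {n}) ?U"
  proof -
    have U: "?U \<in> carrier ?L"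
      unfolding carrier
      by (rule entailsI_total[where f = p1]) (intro computable_intros, simp add: NNO_def)
    have RU: "entails app j ?R ?U"
      by (rule entailsI_total[where f = "\<lambda>n. pair n 0"])
         (intro computable_intros, simp add: nat_subobject_def split: if_splits)
    \<comment> \<open>Realizers of \<open>C\<close> are unknown, but it is strict and avoids
      \<open>D\<close>; passing to \<open>?V\<close> replaces them, inside \<open>j\<close>, by the
      number itself.\<close>
    let ?V = "\<lambda>n. if n \<in> D then {} else {n}"
    have "entails app j C ?V"
      by (rule entails_stable[OF RC(2)[unfolded carrier]]) (use C in \<open>auto simp: NNO_def\<close>)
    moreover have "entails app j ?V ?U"
      by (rule entailsI_total[where f = "\<lambda>n. pair n (Suc 0)"])
         (intro computable_intros, simp split: if_splits)
    ultimately have "entails app j C ?U" by (rule entails_trans)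
    with U RU have "entails app j T ?U"
      using T(2) by (simp add: least_Sub_iff Upper_Sub[OF RC])
    moreover have "(\<lambda>n. {n}) \<in> carrier ?L"
      unfolding carrier by (simp add: NNO_def entails_refl)
    then have "entails app j (\<lambda>n. {n}) T" using T(1) by (simp add: greatest_Sub_iff)
    ultimately show ?thesis by (rule entails_trans[rotated])
  qed
  moreover have "entails app j ?U (\<lambda>n. {?f n})"
    by (rule entailsI_total[where f = p2]) (intro computable_intros, simp)
  ultimately have "entails app j (\<lambda>n. {n}) (\<lambda>n. {?f n})" by (rule entails_trans)
  then show thesis using that unfolding entails_def valid_def by blast
qed

end

section \<open>Arithmetical predicates on powers of the natural numbers\<close>

text \<open>Reads a realizer of \<open>NNO_pow k\<close> as its list. The innermost component is
  discarded because the terminal object is realized by all of \<open>UNIV\<close>; a list of length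
  \<open>k\<close> thus has many codes.\<close>

fun decode_list :: "nat \<Rightarrow> nat \<Rightarrow> nat list" where
  "decode_list 0 n = []"
| "decode_list (Suc k) n = p1 n # decode_list k (p2 n)"

lemma length_decode_list [simp]: "length (decode_list k n) = k"
  by (induction k arbitrary: n) auto

lemma mem_NNO: "n \<in> NNO x y \<longleftrightarrow> x = n \<and> y = n"
  by (auto simp: NNO_def)

lemma mem_NNO_pow: "n \<in> NNO_pow k xs ys \<longleftrightarrow> decode_list k n = xs \<and> decode_list k n = ys"
proof (induction k arbitrary: n xs ys)
  case 0
  show ?case by (cases xs; cases ys) auto
next
  case (Suc k)
  show ?case
    by (cases xs; cases ys) (auto simp: mem_conjR mem_NNO Suc.IH)
qed

section \<open>Packing parameter lists by a term of arithmetic\<close>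

lemma in_context_mono: "in_context \<phi> k \<Longrightarrow> k \<le> m \<Longrightarrow> in_context \<phi> m"
proof -
  have "tm_in_context k t \<Longrightarrow> k \<le> m \<Longrightarrow> tm_in_context m t" for k m t
    by (induction t) auto
  then show "in_context \<phi> k \<Longrightarrow> k \<le> m \<Longrightarrow> in_context \<phi> m"
    by (induction \<phi> arbitrary: k m) auto
qed

lemma tm_val_append: "tm_in_context (length xs) t \<Longrightarrow> tm_val (xs @ zs) t = tm_val xs t"
  by (induction t) (auto simp: nth_append)

lemma std_sat_append: "in_context \<phi> (length xs) \<Longrightarrow> std_sat \<phi> (xs @ zs) \<longleftrightarrow> std_sat \<phi> xs"
proof (induction \<phi> arbitrary: xs)
  case (All \<phi>)
  have "std_sat \<phi> (x # xs @ zs) \<longleftrightarrow> std_sat \<phi> (x # xs)" for x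
    using All.IH[of "x # xs"] All.prems by simp
  then show ?case by simp
next
  case (Ex \<phi>)
  have "std_sat \<phi> (x # xs @ zs) \<longleftrightarrow> std_sat \<phi> (x # xs)" for x
    using Ex.IH[of "x # xs"] Ex.prems by simp
  then show ?case by simp
qed (auto simp: tm_val_append)

text \<open>Unlike \<^const>\<open>prod_encode\<close>, the map \<open>(x, c) \<mapsto> (x + c)\<^sup>2 + x\<close> is the value of a term of arithmetic.\<close>

fun list_code :: "nat list \<Rightarrow> nat" where
  "list_code [] = 0"
| "list_code (x # xs) = (x + list_code xs) * (x + list_code xs) + x"

text \<open>With \<open>s = x + c\<close> one has \<open>x \<le> s\<close>, so the value lies
  between the square of \<open>s\<close> and that of \<open>s + 1\<close>. It determines
  \<open>s\<close>, then \<open>x\<close>, then \<open>c\<close>.\<close>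

lemma square_plus_inj:
  fixes x c y d :: nat
  assumes "(x + c) * (x + c) + x = (y + d) * (y + d) + y"
  shows "x = y \<and> c = d"
proof -
  have less: False if "x + c < y + d" "(x + c) * (x + c) + x = (y + d) * (y + d) + y" for x c y d :: nat
  proof -
    have "(x + c + 1) * (x + c + 1) \<le> (y + d) * (y + d)"
      using that(1) by (intro mult_mono) auto
    with that(2) show False by (simp add: algebra_simps)
  qed
  have "x + c = y + d"
    using less[OF _ assms] less[OF _ assms[symmetric]] by (meson linorder_neqE_nat)
  with assms show ?thesis by simp
qed

lemma list_code_inj: "length xs = length ys \<Longrightarrow> list_code xs = list_code ys \<Longrightarrow> xs = ys"
  by (induction xs ys rule: list_induct2) (auto dest: square_plus_inj)

fun code_tm :: "nat \<Rightarrow> nat \<Rightarrow> tm" where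
  "code_tm i 0 = Zero"
| "code_tm i (Suc k) =
     (let s = Plus (Var i) (code_tm (Suc i) k) in Plus (Times s s) (Var i))"

lemma tm_val_code_tm: "i + k \<le> length zs \<Longrightarrow> tm_val zs (code_tm i k) = list_code (take k (drop i zs))"
proof (induction k arbitrary: i)
  case (Suc k)
  then have "take (Suc k) (drop i zs) = zs ! i # take k (drop (Suc i) zs)"
    by (metis Cons_nth_drop_Suc add_Suc_right less_le_trans less_add_Suc1 take_Suc_Cons)
  with Suc show ?case by (simp add: Let_def)
qed simp

lemma tm_in_context_code_tm: "i + k \<le> m \<Longrightarrow> tm_in_context m (code_tm i k)"
  by (induction k arbitrary: i) (auto simp: Let_def)

lemma in_context_Ex_funpow: "in_context ((Ex ^^ k) \<phi>) m \<longleftrightarrow> in_context \<phi> (k + m)"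
  by (induction k arbitrary: m) auto

lemma std_sat_Ex_funpow: "std_sat ((Ex ^^ k) \<phi>) zs \<longleftrightarrow> (\<exists>ys. length ys = k \<and> std_sat \<phi> (ys @ zs))"
proof (induction k arbitrary: zs)
  case (Suc k)
  have "std_sat ((Ex ^^ Suc k) \<phi>) zs \<longleftrightarrow> (\<exists>x ys. length ys = k \<and> std_sat \<phi> (ys @ x # zs))"
    using Suc.IH by simp
  also have "\<dots> \<longleftrightarrow> (\<exists>ys. length ys = Suc k \<and> std_sat \<phi> (ys @ zs))"
    \<comment> \<open>The outermost quantifier binds the last entry of the prefix, so the list is
      split at its end.\<close>
    unfolding length_Suc_conv_rev by fastforce
  finally show ?case .
qed simp

lemma arithmetical_list_code:
  assumes "in_context \<phi> k"
  shows "arithmetical {list_code xs |xs. length xs = k \<and> std_sat \<phi> xs}"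
  unfolding arithmetical_def
proof (intro exI conjI)
  \<comment> \<open>The quantifiers bind the entries of the list as variables 0 to
    \<open>k - 1\<close>, which pushes the given number to index \<open>k\<close>.\<close>
  let ?\<psi> = "(Ex ^^ k) (And (Eq (code_tm 0 k) (Var k)) \<phi>)"
  show "in_context ?\<psi> 1"
    using assms by (auto simp: in_context_Ex_funpow tm_in_context_code_tm intro: in_context_mono)
  show "{list_code xs |xs. length xs = k \<and> std_sat \<phi> xs} = {n. std_sat ?\<psi> [n]}"
    using assms by (auto simp: std_sat_Ex_funpow tm_val_code_tm std_sat_append)
qed

context kleene
begin

lemma computable_decode_list_nth: "i < k \<Longrightarrow> computable (\<lambda>n. Some (decode_list k n ! i))"
proof (induction k arbitrary: i)
  case (Suc k)
  show ?case
  proof (cases i)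
    case (Suc i')
    with Suc.prems have "computable (\<lambda>n. Some (decode_list k n ! i'))" by (intro Suc.IH) simp
    from computable_compose[OF this computable_p2[OF computable_id]]
    have "computable (\<lambda>n. Some (decode_list k (p2 n) ! i'))" .
    with Suc show ?thesis by simp
  qed (simp add: computable_p1 computable_id)
qed simp

lemma computable_list_code: "computable (\<lambda>n. Some (list_code (decode_list k n)))"
proof (induction k)
  case (Suc k)
  have "computable (\<lambda>n. Some (list_code (decode_list k (p2 n))))"
    by (intro computable_compose[OF Suc.IH] computable_intros)
  then show ?case by (simp add: computable_plus computable_times computable_p1 computable_id)
qed (simp add: computable_const)

lemma computable_tm_val: "tm_in_context k t \<Longrightarrow> computable (\<lambda>n. Some (tm_val (decode_list k n) t))"
  by (induction t) (simp_all add: computable_decode_list_nth computable_const computable_Suc computable_plus computable_times)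

section \<open>Realizers of the morphisms denoted by terms\<close>

lemma mem_tm_mor_Var: "a \<in> tm_mor k (Var i) xs y \<longleftrightarrow> decode_list k (p1 a) = xs \<and> y = xs ! i \<and> p2 a = y"
  by (auto simp: graph_mor_def mem_conjR mem_NNO mem_NNO_pow)

lemma mem_tm_mor_Zero: "a \<in> tm_mor k Zero xs y \<longleftrightarrow> decode_list k (p1 a) = xs \<and> y = 0 \<and> p2 a = y"
  by (auto simp: graph_mor_def mem_conjR mem_NNO mem_NNO_pow)

lemma mem_tm_mor_Succ:
  "a \<in> tm_mor k (Succ t) xs y \<longleftrightarrow>
     (\<exists>u. p1 a \<in> tm_mor k t xs u \<and> p1 (p2 a) = u \<and> y = Suc u \<and> p2 (p2 a) = y)"
  by (auto simp: comp_mor_def graph_mor_def mem_conjR mem_NNO)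

lemma mem_tm_mor_Plus:
  "a \<in> tm_mor k (Plus s t) xs y \<longleftrightarrow>
     (\<exists>u v. p1 (p1 a) \<in> tm_mor k s xs u \<and> p2 (p1 a) \<in> tm_mor k t xs v \<and>
       p1 (p1 (p2 a)) = u \<and> p2 (p1 (p2 a)) = v \<and> y = u + v \<and> p2 (p2 a) = y)"
  by (auto simp: comp_mor_def graph_mor_def pair_mor_def prod_obj_def mem_conjR mem_NNO)

lemma mem_tm_mor_Times:
  "a \<in> tm_mor k (Times s t) xs y \<longleftrightarrow>
     (\<exists>u v. p1 (p1 a) \<in> tm_mor k s xs u \<and> p2 (p1 a) \<in> tm_mor k t xs v \<and>
       p1 (p1 (p2 a)) = u \<and> p2 (p1 (p2 a)) = v \<and> y = u * v \<and> p2 (p2 a) = y)"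
  by (auto simp: comp_mor_def graph_mor_def pair_mor_def prod_obj_def mem_conjR mem_NNO)

lemmas mem_tm_mor = mem_tm_mor_Var mem_tm_mor_Zero mem_tm_mor_Succ mem_tm_mor_Plus mem_tm_mor_Times

lemma tm_mor_sound: "a \<in> tm_mor k t xs y \<Longrightarrow> y = tm_val xs t"
  by (induction t arbitrary: a y) (auto simp: mem_tm_mor simp del: tm_mor.simps)

text \<open>A realizer contains the realizers for all subterms; following the leftmost one down to a
  variable or \<open>Zero\<close> reaches a code of the context.\<close>

lemma tm_mor_strict:
  "\<exists>f. computable (\<lambda>x. Some (f x)) \<and> (\<forall>xs y. \<forall>a\<in>tm_mor k t xs y. decode_list k (f a) = xs)"
proof (induction t)
  case (Var i)
  show ?case by (rule exI[of _ p1]) (auto simp: mem_tm_mor computable_p1 computable_id simp del: tm_mor.simps)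
next
  case Zero
  show ?case by (rule exI[of _ p1]) (auto simp: mem_tm_mor computable_p1 computable_id simp del: tm_mor.simps)
next
  case (Succ t)
  then obtain f where f: "computable (\<lambda>x. Some (f x))" "\<And>xs y a. a \<in> tm_mor k t xs y \<Longrightarrow> decode_list k (f a) = xs"
    by blast
  show ?case
  proof (intro exI conjI allI ballI)
    show "computable (\<lambda>a. Some (f (p1 a)))" by (intro computable_compose[OF f(1)] computable_intros)
    show "decode_list k (f (p1 a)) = xs" if "a \<in> tm_mor k (Succ t) xs y" for xs y a
      using that unfolding mem_tm_mor by (elim exE conjE) (erule f(2))
  qed
next
  case (Plus s t)
  from Plus.IH(1) obtain f where f: "computable (\<lambda>x. Some (f x))" "\<And>xs y a. a \<in> tm_mor k s xs y \<Longrightarrow> decode_list k (f a) = xs"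
    by blast
  show ?case
  proof (intro exI conjI allI ballI)
    show "computable (\<lambda>a. Some (f (p1 (p1 a))))" by (intro computable_compose[OF f(1)] computable_intros)
    show "decode_list k (f (p1 (p1 a))) = xs" if "a \<in> tm_mor k (Plus s t) xs y" for xs y a
      using that unfolding mem_tm_mor by (elim exE conjE) (erule f(2))
  qed
next
  case (Times s t)
  from Times.IH(1) obtain f where f: "computable (\<lambda>x. Some (f x))" "\<And>xs y a. a \<in> tm_mor k s xs y \<Longrightarrow> decode_list k (f a) = xs"
    by blast
  show ?case
  proof (intro exI conjI allI ballI)
    show "computable (\<lambda>a. Some (f (p1 (p1 a))))" by (intro computable_compose[OF f(1)] computable_intros)
    show "decode_list k (f (p1 (p1 a))) = xs" if "a \<in> tm_mor k (Times s t) xs y" for xs y a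
      using that unfolding mem_tm_mor by (elim exE conjE) (erule f(2))
  qed
qed

lemma tm_mor_complete:
  "tm_in_context k t \<Longrightarrow>
   \<exists>f. computable (\<lambda>x. Some (f x)) \<and> (\<forall>n. f n \<in> tm_mor k t (decode_list k n) (tm_val (decode_list k n) t))"
proof (induction t)
  case (Var i)
  then show ?case
    by (intro exI[of _ "\<lambda>n. pair n (decode_list k n ! i)"])
       (auto simp: mem_tm_mor computable_pair computable_id computable_decode_list_nth simp del: tm_mor.simps)
next
  case Zero
  show ?case
    by (rule exI[of _ "\<lambda>n. pair n 0"])
       (auto simp: mem_tm_mor computable_pair computable_id computable_const simp del: tm_mor.simps)
next
  case (Succ t)
  then obtain f where f: "computable (\<lambda>x. Some (f x))" "\<And>n. f n \<in> tm_mor k t (decode_list k n) (tm_val (decode_list k n) t)"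
    by auto
  have "computable (\<lambda>n. Some (tm_val (decode_list k n) t))" using Succ.prems by (simp add: computable_tm_val)
  with f show ?case
    by (intro exI[of _ "\<lambda>n. pair (f n) (pair (tm_val (decode_list k n) t) (Suc (tm_val (decode_list k n) t)))"])
       (auto simp: mem_tm_mor computable_pair computable_Suc simp del: tm_mor.simps)
next
  case (Plus s t)
  then obtain f g where f: "computable (\<lambda>x. Some (f x))" "\<And>n. f n \<in> tm_mor k s (decode_list k n) (tm_val (decode_list k n) s)"
    and g: "computable (\<lambda>x. Some (g x))" "\<And>n. g n \<in> tm_mor k t (decode_list k n) (tm_val (decode_list k n) t)"
    by auto
  let ?u = "\<lambda>n. tm_val (decode_list k n) s" and ?v = "\<lambda>n. tm_val (decode_list k n) t"
  have "computable (\<lambda>n. Some (?u n))" "computable (\<lambda>n. Some (?v n))"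
    using Plus.prems by (simp_all add: computable_tm_val)
  with f g show ?case
    by (intro exI[of _ "\<lambda>n. pair (pair (f n) (g n)) (pair (pair (?u n) (?v n)) (?u n + ?v n))"])
       (auto simp: mem_tm_mor computable_pair computable_plus simp del: tm_mor.simps)
next
  case (Times s t)
  then obtain f g where f: "computable (\<lambda>x. Some (f x))" "\<And>n. f n \<in> tm_mor k s (decode_list k n) (tm_val (decode_list k n) s)"
    and g: "computable (\<lambda>x. Some (g x))" "\<And>n. g n \<in> tm_mor k t (decode_list k n) (tm_val (decode_list k n) t)"
    by auto
  let ?u = "\<lambda>n. tm_val (decode_list k n) s" and ?v = "\<lambda>n. tm_val (decode_list k n) t"
  have "computable (\<lambda>n. Some (?u n))" "computable (\<lambda>n. Some (?v n))"
    using Times.prems by (simp_all add: computable_tm_val)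
  with f g show ?case
    by (intro exI[of _ "\<lambda>n. pair (pair (f n) (g n)) (pair (pair (?u n) (?v n)) (?u n * ?v n))"])
       (auto simp: mem_tm_mor computable_pair computable_times simp del: tm_mor.simps)
qed

end

section \<open>Interpretation of formulas by closed predicates\<close>

definition closed_pred :: "nat \<Rightarrow> (nat list \<Rightarrow> bool) \<Rightarrow> nat list \<Rightarrow> nat set" where
  "closed_pred k P = (\<lambda>xs. {n. decode_list k n = xs \<and> P xs})"

lemma mem_closed_pred: "n \<in> closed_pred k P xs \<longleftrightarrow> decode_list k n = xs \<and> P xs"
  by (simp add: closed_pred_def)

context subtopos
begin

lemma discrete_NNO_pow: "discrete (NNO_pow k)"
  unfolding discrete_def by (metis all_not_in_conv mem_NNO_pow)

lemmas carrier_NNO_pow = carrier_Sub_iff[OF discrete_NNO_pow]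

lemma closed_pred_carrier: "closed_pred k P \<in> carrier (Sub app j (NNO_pow k))"
  unfolding carrier_NNO_pow
  by (rule entailsI_total[OF computable_id]) (simp add: mem_closed_pred mem_NNO_pow)

text \<open>Where \<open>P\<close> holds, the closed predicate equals the existence predicate of
  \<open>NNO_pow k\<close>, so the strictness realizer of \<open>T\<close> already suffices.\<close>

lemma entails_closed_pred:
  assumes "T \<in> carrier (Sub app j (NNO_pow k))" "\<And>xs a. a \<in> T xs \<Longrightarrow> P xs"
  shows "entails app j T (closed_pred k P)"
proof (rule entails_stable[OF assms(1)[unfolded carrier_NNO_pow]])
  fix xs a b assume "a \<in> T xs"
  then have "P xs" by (rule assms(2))
  then show "closed_pred k P xs = NNO_pow k xs xs" by (auto simp: mem_closed_pred mem_NNO_pow)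
qed

text \<open>Excludes lists of the wrong length. The code is merely known to exist and is used to
  inhabit other predicates at \<open>xs\<close>; no realizer computes it.\<close>

lemma carrier_nonempty:
  assumes "T \<in> carrier (Sub app j (NNO_pow k))" "a \<in> T xs"
  obtains n where "decode_list k n = xs"
proof -
  have "NNO_pow k xs xs \<noteq> {}"
    using assms unfolding carrier_NNO_pow by (rule entails_nonempty)
  then obtain n where "n \<in> NNO_pow k xs xs" by blast
  then show thesis by (intro that) (simp add: mem_NNO_pow)
qed

lemma entails_closed_predD: "entails app j T (closed_pred k P) \<Longrightarrow> a \<in> T xs \<Longrightarrow> P xs"
  using entails_nonempty[of T "closed_pred k P"] by (fastforce simp: mem_closed_pred)

lemma mem_pullback_weakening:
  "a \<in> pullback (weakening k) T ys \<longleftrightarrow>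
     decode_list (Suc k) (p1 (p1 a)) = ys \<and> decode_list k (p2 (p1 a)) = tl ys \<and> p2 a \<in> T (tl ys)"
  by (auto simp: pullback_def weakening_def graph_mor_def mem_conjR mem_NNO_pow simp del: decode_list.simps NNO_pow.simps)

lemma mem_pullback_diagonal:
  "a \<in> pullback (pair_mor F G) (diagonal NNO) xs \<longleftrightarrow>
     p1 (p1 a) \<in> F xs (p2 a) \<and> p2 (p1 a) \<in> G xs (p2 a)"
  by (auto simp: pullback_def pair_mor_def diagonal_def mem_conjR mem_NNO)

lemma interp_Eq:
  assumes "tm_in_context k s" "tm_in_context k t"
  shows "interp app j (Eq s t) k (closed_pred k (std_sat (Eq s t)))"
proof -
  let ?D = "pullback (pair_mor (tm_mor k s) (tm_mor k t)) (diagonal NNO)"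
  let ?R = "closed_pred k (std_sat (Eq s t))"
  obtain f where f: "computable (\<lambda>x. Some (f x))" "\<And>n. f n \<in> tm_mor k s (decode_list k n) (tm_val (decode_list k n) s)"
    using tm_mor_complete[OF assms(1)] by blast
  obtain g where g: "computable (\<lambda>x. Some (g x))" "\<And>n. g n \<in> tm_mor k t (decode_list k n) (tm_val (decode_list k n) t)"
    using tm_mor_complete[OF assms(2)] by blast
  obtain h where h: "computable (\<lambda>x. Some (h x))" "\<And>xs y a. a \<in> tm_mor k s xs y \<Longrightarrow> decode_list k (h a) = xs"
    using tm_mor_strict[of k s] by blast
  have "entails app j ?R ?D"
  proof (rule entailsI_total)
    show "computable (\<lambda>n. Some (pair (pair (f n) (g n)) (tm_val (decode_list k n) s)))"
      by (intro computable_intros f g computable_tm_val assms)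
    show "pair (pair (f n) (g n)) (tm_val (decode_list k n) s) \<in> ?D xs" if "n \<in> ?R xs" for xs n
      using that f(2)[of n] g(2)[of n] by (auto simp: mem_closed_pred mem_pullback_diagonal)
  qed
  moreover have "entails app j ?D ?R"
  proof (rule entailsI_total)
    show "computable (\<lambda>n. Some (h (p1 (p1 n))))"
      by (intro computable_compose[OF h(1)] computable_intros)
    show "h (p1 (p1 a)) \<in> ?R xs" if "a \<in> ?D xs" for xs a
    proof -
      have a: "p1 (p1 a) \<in> tm_mor k s xs (p2 a)" "p2 (p1 a) \<in> tm_mor k t xs (p2 a)"
        using that by (simp_all add: mem_pullback_diagonal)
      with h(2)[OF a(1)] show ?thesis by (simp add: mem_closed_pred flip: a[THEN tm_mor_sound])
    qed
  qed
  ultimately show ?thesis by (simp add: closed_pred_carrier eq_Sub)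
qed

lemma interp_Fls: "interp app j Fls k (closed_pred k (std_sat Fls))"
  using closed_pred_carrier[of k "\<lambda>_. False"]
  by (simp add: least_Sub_iff closed_pred_def entails_empty)

lemma interp_And:
  assumes "interp app j \<phi> k (closed_pred k (std_sat \<phi>))" "interp app j \<psi> k (closed_pred k (std_sat \<psi>))"
  shows "interp app j (And \<phi> \<psi>) k (closed_pred k (std_sat (And \<phi> \<psi>)))"
proof -
  have "entails app j (closed_pred k (std_sat (And \<phi> \<psi>))) (closed_pred k (std_sat \<theta>))" if "\<theta> \<in> {\<phi>, \<psi>}" for \<theta>
    using that by (intro entails_closed_pred closed_pred_carrier) (auto simp: mem_closed_pred)
  moreover have "entails app j T (closed_pred k (std_sat (And \<phi> \<psi>)))"
    if "T \<in> carrier (Sub app j (NNO_pow k))" "entails app j T (closed_pred k (std_sat \<phi>))"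
      "entails app j T (closed_pred k (std_sat \<psi>))" for T
    using that by (intro entails_closed_pred) (auto dest: entails_closed_predD)
  ultimately have "greatest (Sub app j (NNO_pow k)) (closed_pred k (std_sat (And \<phi> \<psi>)))
      (Lower (Sub app j (NNO_pow k)) {closed_pred k (std_sat \<phi>), closed_pred k (std_sat \<psi>)})"
    by (auto simp: greatest_Sub_iff Lower_Sub closed_pred_carrier)
  with assms show ?thesis unfolding interp.simps by blast
qed

lemma interp_Imp:
  assumes "interp app j \<phi> k (closed_pred k (std_sat \<phi>))" "interp app j \<psi> k (closed_pred k (std_sat \<psi>))"
  shows "interp app j (Imp \<phi> \<psi>) k (closed_pred k (std_sat (Imp \<phi> \<psi>)))"
proof -
  let ?L = "Sub app j (NNO_pow k)"
  let ?P = "closed_pred k (std_sat \<phi>)" and ?Q = "closed_pred k (std_sat \<psi>)"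
  let ?R = "closed_pred k (std_sat (Imp \<phi> \<psi>))"
  let ?A = "{T \<in> carrier ?L. \<forall>M. greatest ?L M (Lower ?L {T, ?P}) \<longrightarrow> le ?L M ?Q}"
  have "entails app j M ?Q" if "greatest ?L M (Lower ?L {?R, ?P})" for M
  proof -
    have M: "M \<in> carrier ?L" "entails app j M ?R" "entails app j M ?P"
      using that by (auto simp: greatest_Sub_iff Lower_Sub closed_pred_carrier)
    then show ?thesis
      using entails_closed_predD[OF M(2)] entails_closed_predD[OF M(3)]
      by (intro entails_closed_pred) auto
  qed
  moreover have "entails app j T ?R" if T: "T \<in> ?A" for T
  proof (rule entails_closed_pred)
    show carrier: "T \<in> carrier ?L" using T by blast
    \<comment> \<open>The condition on \<open>T\<close> concerns every meet with \<open>?P\<close>;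
      it is applied to the pointwise conjunction.\<close>
    let ?M = "\<lambda>xs. conjR (T xs) (?P xs)"
    have "?M \<in> carrier ?L"
      using carrier unfolding carrier_NNO_pow by (rule entails_trans[OF entails_conjD1])
    then have "greatest ?L ?M (Lower ?L {T, ?P})"
      using carrier
      by (auto simp: greatest_Sub_iff Lower_Sub closed_pred_carrier entails_conjI entails_conjD1 entails_conjD2)
    with T have M: "entails app j ?M ?Q" by (simp add: le_Sub)
    fix xs a assume a: "a \<in> T xs"
    with carrier obtain n where n: "decode_list k n = xs" by (rule carrier_nonempty)
    have "std_sat \<psi> xs" if "std_sat \<phi> xs"
    proof (rule entails_closed_predD[OF M])
      show "pair a n \<in> ?M xs" using a n that by (simp add: mem_conjR mem_closed_pred)
    qed
    then show "std_sat (Imp \<phi> \<psi>) xs" by simp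
  qed
  ultimately have "greatest ?L ?R ?A"
    unfolding greatest_Sub_iff by (auto simp: le_Sub closed_pred_carrier simp del: std_sat.simps)
  with assms show ?thesis unfolding interp.simps by blast
qed

lemma interp_All:
  assumes "interp app j \<phi> (Suc k) (closed_pred (Suc k) (std_sat \<phi>))"
  shows "interp app j (All \<phi>) k (closed_pred k (std_sat (All \<phi>)))"
proof -
  let ?L = "Sub app j (NNO_pow k)"
  let ?P = "closed_pred (Suc k) (std_sat \<phi>)" and ?R = "closed_pred k (std_sat (All \<phi>))"
  let ?A = "{T \<in> carrier ?L. le (Sub app j (NNO_pow (Suc k))) (pullback (weakening k) T) ?P}"
  have "entails app j (pullback (weakening k) ?R) ?P"
  proof (rule entailsI_total)
    show "computable (\<lambda>a. Some (p1 (p1 a)))" by (intro computable_intros)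
    show "p1 (p1 a) \<in> ?P ys" if "a \<in> pullback (weakening k) ?R ys" for ys a
      using that by (auto simp: mem_pullback_weakening mem_closed_pred)
  qed
  moreover have "entails app j T ?R" if T: "T \<in> ?A" for T
  proof (rule entails_closed_pred)
    show carrier: "T \<in> carrier ?L" using T by blast
    fix xs a assume a: "a \<in> T xs"
    with carrier obtain n where n: "decode_list k n = xs" by (rule carrier_nonempty)
    have "std_sat \<phi> (x # xs)" for x
    proof (rule entails_closed_predD)
      show "entails app j (pullback (weakening k) T) ?P" using T by (simp add: le_Sub)
      \<comment> \<open>The three parts are a code of \<open>x # xs\<close>, a code of its tail, and
        the element of \<open>T\<close>.\<close>
      show "pair (pair (pair x n) n) a \<in> pullback (weakening k) T (x # xs)"
        using a n by (simp add: mem_pullback_weakening)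
    qed
    then show "std_sat (All \<phi>) xs" by simp
  qed
  ultimately have "greatest ?L ?R ?A"
    unfolding greatest_Sub_iff by (auto simp: le_Sub closed_pred_carrier simp del: std_sat.simps)
  with assms show ?thesis unfolding interp.simps by blast
qed

end

locale arithmetical_subtopos = subtopos +
  assumes forces_decidable: "arithmetical D \<Longrightarrow> forces_decidable app j D"
begin

lemma decide_formula:
  assumes "in_context \<phi> k"
  obtains d where "\<And>n. d \<in> impR app {n} (j {if std_sat \<phi> (decode_list k n) then 0 else Suc 0})"
proof -
  let ?D = "{list_code xs |xs. length xs = k \<and> std_sat \<phi> xs}"
  obtain e where e: "\<And>n. e \<in> impR app {n} (j {if n \<in> ?D then 0 else Suc 0})"
    using forces_decidable[OF arithmetical_list_code[OF assms]] by (rule forces_decidable_realizer) blast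
  have "computable (\<lambda>n. app e (list_code (decode_list k n)))"
    by (intro computable_intros computable_list_code)
  then obtain d where d: "\<And>n. app d n = app e (list_code (decode_list k n))" unfolding computable_def by blast
  \<comment> \<open>Injectivity on lists of equal length prevents another list from putting this
    code into \<open>?D\<close>.\<close>
  have "list_code (decode_list k n) \<in> ?D \<longleftrightarrow> std_sat \<phi> (decode_list k n)" for n
    by (auto dest: list_code_inj[rotated])
  then have "d \<in> impR app {n} (j {if std_sat \<phi> (decode_list k n) then 0 else Suc 0})" for n
    using e[of "list_code (decode_list k n)"] by (simp add: impR_def d)
  then show thesis using that by blast
qed

text \<open>Definition by cases on a formula that need not be decidable in the effective topos itself.\<close>

lemma decide_cases:
  assumes "in_context \<phi> k" "computable (\<lambda>z. Some (c z))" "computable f" "computable g"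
  obtains h where "computable h"
    "\<And>z p. (std_sat \<phi> (decode_list k (c z)) \<Longrightarrow> \<exists>b\<in>j p. f z = Some b) \<Longrightarrow>
           (\<not> std_sat \<phi> (decode_list k (c z)) \<Longrightarrow> \<exists>b\<in>j p. g z = Some b) \<Longrightarrow> \<exists>b\<in>j p. h z = Some b"
proof -
  obtain d where d: "\<And>n. d \<in> impR app {n} (j {if std_sat \<phi> (decode_list k n) then 0 else Suc 0})"
    using decide_formula[OF assms(1)] by blast
  obtain b where b: "computable (\<lambda>x. Some (b x))"
    "\<And>h p q. h \<in> impR app p (j q) \<Longrightarrow> b h \<in> impR app (j p) (j q)"
    using j_bind by blast
  \<comment> \<open>The operation \<open>b\<close> passes on only the truth value, so
    \<open>z\<close> has to be built into the continuation \<open>s z\<close>.\<close>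
  have "computable (\<lambda>z. if p2 z = 0 then f (p1 z) else g (p1 z))"
    by (intro computable_intros computable_comp[OF assms(3)] computable_comp[OF assms(4)])
  then obtain s where s: "computable (\<lambda>z. Some (s z))" "\<And>z v. app (s z) v = (if v = 0 then f z else g z)"
    by (rule abstraction) auto
  show thesis
  proof (rule that)
    show "computable (\<lambda>z. Option.bind (app d (c z)) (app (b (s z))))"
      by (intro computable_intros assms(2) computable_compose[OF b(1)] computable_compose[OF s(1)])
    fix z p
    let ?v = "if std_sat \<phi> (decode_list k (c z)) then 0 else Suc 0"
    assume "std_sat \<phi> (decode_list k (c z)) \<Longrightarrow> \<exists>b\<in>j p. f z = Some b"
      and "\<not> std_sat \<phi> (decode_list k (c z)) \<Longrightarrow> \<exists>b\<in>j p. g z = Some b"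
    then have "s z \<in> impR app {?v} (j p)"
      by (intro impRI) (auto simp: s(2))
    then have bs: "b (s z) \<in> impR app (j {?v}) (j p)" by (rule b(2))
    obtain y where y: "app d (c z) = Some y" "y \<in> j {?v}" using d by (rule impRE) simp
    from bs y(2) obtain w where "app (b (s z)) y = Some w" "w \<in> j p" by (rule impRE)
    with y(1) show "\<exists>w\<in>j p. Option.bind (app d (c z)) (app (b (s z))) = Some w" by simp
  qed
qed

text \<open>Deciding the left disjunct is enough: where it fails, a point of \<open>?R\<close>
  satisfies the right one. In either case the same code realizes the chosen disjunct.\<close>

lemma interp_Or:
  assumes "in_context \<phi> k"
    and "interp app j \<phi> k (closed_pred k (std_sat \<phi>))" "interp app j \<psi> k (closed_pred k (std_sat \<psi>))"
  shows "interp app j (Or \<phi> \<psi>) k (closed_pred k (std_sat (Or \<phi> \<psi>)))"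
proof -
  let ?P = "closed_pred k (std_sat \<phi>)" and ?Q = "closed_pred k (std_sat \<psi>)"
  let ?R = "closed_pred k (std_sat (Or \<phi> \<psi>))"
  have "entails app j ?R T" if T: "entails app j ?P T" "entails app j ?Q T" for T
  proof -
    obtain a where a: "\<And>xs. a \<in> impR app (?P xs) (j (T xs))"
      using T(1) unfolding entails_def valid_def by blast
    obtain b where b: "\<And>xs. b \<in> impR app (?Q xs) (j (T xs))"
      using T(2) unfolding entails_def valid_def by blast
    have "computable (app a)" "computable (app b)" unfolding computable_def by auto
    from decide_cases[OF assms(1) computable_id this] obtain h where h: "computable h"
      "\<And>n p. (std_sat \<phi> (decode_list k n) \<Longrightarrow> \<exists>v\<in>j p. app a n = Some v) \<Longrightarrow>
             (\<not> std_sat \<phi> (decode_list k n) \<Longrightarrow> \<exists>v\<in>j p. app b n = Some v) \<Longrightarrow> \<exists>v\<in>j p. h n = Some v"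
      by blast
    show ?thesis
    proof (rule entailsI_local[OF h(1)], rule h(2))
      fix xs n assume n: "n \<in> ?R xs"
      show "\<exists>v\<in>j (T xs). app a n = Some v" if "std_sat \<phi> (decode_list k n)"
        using n that impRE[OF a[of xs], of n] by (auto simp: mem_closed_pred)
      show "\<exists>v\<in>j (T xs). app b n = Some v" if "\<not> std_sat \<phi> (decode_list k n)"
        using n that impRE[OF b[of xs], of n] by (auto simp: mem_closed_pred)
    qed
  qed
  moreover have "entails app j ?P ?R" "entails app j ?Q ?R"
    by (intro entails_closed_pred closed_pred_carrier; simp add: mem_closed_pred)+
  ultimately have "least (Sub app j (NNO_pow k)) ?R (Upper (Sub app j (NNO_pow k)) {?P, ?Q})"
    by (auto simp: least_Sub_iff Upper_Sub closed_pred_carrier simp del: std_sat.simps)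
  with assms show ?thesis unfolding interp.simps by blast
qed

text \<open>A witness is found by unbounded search, each step of which uses the decision of \<open>\<phi>\<close> provided by \<open>j\<close>;
  for the existence of the result in \<open>j (T xs)\<close> it suffices that the search stops in the standard model.\<close>

lemma entails_Ex_least:
  assumes "in_context \<phi> (Suc k)"
    and "entails app j (closed_pred (Suc k) (std_sat \<phi>)) (pullback (weakening k) T)"
  shows "entails app j (closed_pred k (std_sat (Ex \<phi>))) T"
proof -
  have "entails app j (pullback (weakening k) T) (\<lambda>ys. T (tl ys))"
    by (rule entailsI_total[where f = p2])
       (intro computable_intros, simp add: mem_pullback_weakening del: decode_list.simps)
  with assms(2) have "entails app j (closed_pred (Suc k) (std_sat \<phi>)) (\<lambda>ys. T (tl ys))"
    by (rule entails_trans)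
  then obtain t where t: "\<And>ys. t \<in> impR app (closed_pred (Suc k) (std_sat \<phi>) ys) (j (T (tl ys)))"
    unfolding entails_def valid_def by blast
  \<comment> \<open>Here \<open>z\<close> codes the index of the search itself together with a
    candidate and a code of the parameters. Success hands this pair to \<open>t\<close>; failure
    calls the search on the next candidate.\<close>
  have "computable (\<lambda>z. Some (p2 z))" "computable (\<lambda>z. app t (p2 z))"
    "computable (\<lambda>z. app (p1 z) (pair (Suc (p1 (p2 z))) (p2 (p2 z))))"
    by (intro computable_intros)+
  from decide_cases[OF assms(1) this] obtain h where h: "computable h"
    "\<And>z p. (std_sat \<phi> (decode_list (Suc k) (p2 z)) \<Longrightarrow> \<exists>b\<in>j p. app t (p2 z) = Some b) \<Longrightarrow>
      (\<not> std_sat \<phi> (decode_list (Suc k) (p2 z)) \<Longrightarrow>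
        \<exists>b\<in>j p. app (p1 z) (pair (Suc (p1 (p2 z))) (p2 (p2 z))) = Some b) \<Longrightarrow> \<exists>b\<in>j p. h z = Some b"
    by blast
  obtain e where e: "\<And>y. app e y = h (pair e y)" using recursion_theorem[OF h(1)] by blast
  have hit: "\<exists>b\<in>j (T (decode_list k n)). app t (pair m n) = Some b" if "std_sat \<phi> (m # decode_list k n)" for m n
    using that impRE[OF t[of "m # decode_list k n"], of "pair m n"] by (auto simp: mem_closed_pred)
  have search: "\<exists>b\<in>j (T (decode_list k n)). app e (pair m n) = Some b" if "std_sat \<phi> (x # decode_list k n)" "m \<le> x" for m n x
    using that(2)
  \<comment> \<open>The induction descends from the witness \<open>x\<close>. A smaller candidate
    may succeed early, which is just as good; otherwise its successor is covered already. No bound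
    on \<open>x\<close> enters the program.\<close>
  proof (induction m rule: inc_induct)
    case base
    show ?case unfolding e using that(1) hit by (intro h(2)) auto
  next
    case (step m)
    then show ?case unfolding e[of "pair m n"] using hit by (intro h(2)) auto
  qed
  show ?thesis
  proof (rule entailsI_local)
    show "computable (\<lambda>n. app e (pair 0 n))" by (intro computable_intros)
    show "\<exists>b\<in>j (T xs). app e (pair 0 n) = Some b" if "n \<in> closed_pred k (std_sat (Ex \<phi>)) xs" for xs n
      using that search by (auto simp: mem_closed_pred)
  qed
qed

lemma interp_Ex:
  assumes "in_context \<phi> (Suc k)" "interp app j \<phi> (Suc k) (closed_pred (Suc k) (std_sat \<phi>))"
  shows "interp app j (Ex \<phi>) k (closed_pred k (std_sat (Ex \<phi>)))"
proof -
  let ?L = "Sub app j (NNO_pow k)"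
  let ?P = "closed_pred (Suc k) (std_sat \<phi>)" and ?R = "closed_pred k (std_sat (Ex \<phi>))"
  let ?A = "{T \<in> carrier ?L. le (Sub app j (NNO_pow (Suc k))) ?P (pullback (weakening k) T)}"
  have "entails app j ?P (pullback (weakening k) ?R)"
  proof (rule entailsI_total)
    show "computable (\<lambda>n. Some (pair (pair n (p2 n)) (p2 n)))" by (intro computable_intros)
    show "pair (pair n (p2 n)) (p2 n) \<in> pullback (weakening k) ?R ys" if "n \<in> ?P ys" for ys n
      using that by (auto simp: mem_pullback_weakening mem_closed_pred)
  qed
  then have "least ?L ?R ?A"
    unfolding least_Sub_iff
    by (auto simp: le_Sub closed_pred_carrier entails_Ex_least[OF assms(1)] simp del: std_sat.simps)
  with assms(2) show ?thesis unfolding interp.simps by blast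
qed

lemma interp_closed_pred: "in_context \<phi> k \<Longrightarrow> interp app j \<phi> k (closed_pred k (std_sat \<phi>))"
proof (induction \<phi> arbitrary: k)
  case (Eq s t)
  then show ?case by (intro interp_Eq) auto
next
  case Fls
  show ?case by (rule interp_Fls)
next
  case (And \<phi> \<psi>)
  then show ?case by (intro interp_And) auto
next
  case (Or \<phi> \<psi>)
  then show ?case by (intro interp_Or) auto
next
  case (Imp \<phi> \<psi>)
  then show ?case by (intro interp_Imp) auto
next
  case (All \<phi>)
  then show ?case by (intro interp_All) auto
next
  case (Ex \<phi>)
  then show ?case by (intro interp_Ex) auto
qed

end

theorem theorem6p3:
  fixes app :: "nat \<Rightarrow> nat \<Rightarrow> nat option" and j :: "nat set \<Rightarrow> nat set"
  assumes "kleene_application app"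
    and "local_operator app j"
    and "local_operator_le app j (notnot app)"
    and "\<And>D. arithmetical D \<Longrightarrow> forces_decidable app j D"
  shows "\<And>\<phi>. sentence \<phi> \<Longrightarrow> std_sat \<phi> [] \<Longrightarrow> holds_in_subtopos app j \<phi>"
proof -
  fix \<phi> assume \<phi>: "sentence \<phi>" "std_sat \<phi> []"
  interpret arithmetical_subtopos app j
    using assms by unfold_locales
  let ?R = "closed_pred 0 (std_sat \<phi>)"
  have "interp app j \<phi> 0 ?R"
    using \<phi>(1) by (intro interp_closed_pred) (simp add: sentence_def)
  moreover have "entails app j T ?R" if T: "T \<in> carrier (Sub app j (NNO_pow 0))" for T
    using T
  proof (rule entails_closed_pred)
    fix xs a assume "a \<in> T xs"
    \<comment> \<open>Only the empty list has a code in length 0, so \<open>xs\<close> is the empty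
      context.\<close>
    with T obtain n where "decode_list 0 n = xs" by (rule carrier_nonempty)
    then show "std_sat \<phi> xs" using \<phi>(2) by auto
  qed
  ultimately show "holds_in_subtopos app j \<phi>"
    unfolding holds_in_subtopos_def greatest_Sub_iff using closed_pred_carrier by blast
qed

end
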